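(* Let $f:\{0,1\}^n\times\{0,1\}^n\to[-1,1]$. Then $\bar{\mathrm{R}}_\varepsilon(f)\le\tilde{O}\big((\sigma(f)/\varepsilon)^{2/3}\big)$.
   Context: $A_f$ is the $2^n\times 2^n$ real matrix with $(x,y)$ entry $f(x,y)$, and $\sigma(f)$ is the largest singular value (spectral norm) of $A_f$. Distributed estimation: Alice holds a probability distribution $p$ on $\{0,1\}^n$, Bob holds a probability distribution $q$ on $\{0,1\}^n$, and they must output an estimate within additive error $\varepsilon$ of $\mathbb{E}_{x\sim p,y\sim q}[f(x,y)]$. $\bar{\mathrm{R}}_\varepsilon(f)$ is the minimum worst-case communication of a shared-randomness randomized protocol that succeeds with probability at least $2/3$ on every input pair. $\tilde{O}$ hides polylogarithmic factors in $1/\varepsilon$ only. *)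

theory Defs
  imports "HOL-Probability.Probability_Mass_Function" "Jordan_Normal_Form.Char_Poly"
    "HOL-Library.Extended_Real"
begin

definition cube :: "nat \<Rightarrow> bool list set" where
  "cube n = {x. length x = n}"

text \<open>The rows and columns are indexed by the strings of length \<open>n\<close>, in the order in which
  \<^const>\<open>List.n_lists\<close> enumerates them; the singular values do not depend on this order.\<close>

definition comm_matrix :: "nat \<Rightarrow> (bool list \<Rightarrow> bool list \<Rightarrow> real) \<Rightarrow> real Matrix.mat" where
  "comm_matrix n f = Matrix.mat (2 ^ n) (2 ^ n)
     (\<lambda>(i, j). f (List.n_lists n [False, True] ! i) (List.n_lists n [False, True] ! j))"

definition singular_values :: "real Matrix.mat \<Rightarrow> real set" where
  "singular_values A = {s. s \<ge> 0 \<and> eigenvalue (transpose_mat A * A) (s\<^sup>2)}"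

definition max_singular_value :: "nat \<Rightarrow> (bool list \<Rightarrow> bool list \<Rightarrow> real) \<Rightarrow> real" where
  "max_singular_value n f = Max (singular_values (comm_matrix n f))"

text \<open>Deterministic two-party protocols as binary trees. At an inner node the named party
  announces one bit, computed from its own input; the play moves to the first subtree if the bit
  is true and to the second otherwise. A leaf carries the common output.\<close>

datatype ('a, 'b, 'c) protocol =
    Output 'c
  | Alice "'a \<Rightarrow> bool" "('a, 'b, 'c) protocol" "('a, 'b, 'c) protocol"
  | Bob "'b \<Rightarrow> bool" "('a, 'b, 'c) protocol" "('a, 'b, 'c) protocol"

primrec run :: "('a, 'b, 'c) protocol \<Rightarrow> 'a \<Rightarrow> 'b \<Rightarrow> 'c" where
  "run (Output c) a b = c"
| "run (Alice h l r) a b = (if h a then run l a b else run r a b)"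
| "run (Bob h l r) a b = (if h b then run l a b else run r a b)"

primrec depth :: "('a, 'b, 'c) protocol \<Rightarrow> nat" where
  "depth (Output c) = 0"
| "depth (Alice h l r) = Suc (max (depth l) (depth r))"
| "depth (Bob h l r) = Suc (max (depth l) (depth r))"

text \<open>A shared-randomness protocol is a probability distribution over deterministic protocols.
  The parties' inputs are themselves distributions on the cube.\<close>

type_synonym estimation_protocol = "(bool list pmf, bool list pmf, real) protocol pmf"

definition estimates ::
  "nat \<Rightarrow> (bool list \<Rightarrow> bool list \<Rightarrow> real) \<Rightarrow> real \<Rightarrow> estimation_protocol \<Rightarrow> bool" where
  "estimates n f \<epsilon> P \<longleftrightarrow>
     (\<forall>p q. set_pmf p \<subseteq> cube n \<longrightarrow> set_pmf q \<subseteq> cube n \<longrightarrow>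
        measure_pmf.prob P
          {\<pi>. \<bar>run \<pi> p q - measure_pmf.expectation (pair_pmf p q) (\<lambda>(x, y). f x y)\<bar> \<le> \<epsilon>}
        \<ge> 2 / 3)"

text \<open>The infimum is taken in \<^typ>\<open>enat\<close>, so that it would be \<open>\<infinity>\<close> if no protocol succeeded.\<close>

definition estimation_complexity ::
  "real \<Rightarrow> nat \<Rightarrow> (bool list \<Rightarrow> bool list \<Rightarrow> real) \<Rightarrow> enat" where
  "estimation_complexity \<epsilon> n f =
     Inf {enat d | d. \<exists>P. estimates n f \<epsilon> P \<and> (\<forall>\<pi>\<in>set_pmf P. depth \<pi> \<le> d)}"

end

theory Submission imports Defs begin

text \<open>Both parties replace their distribution by the empirical distribution of
  \<open>m = O(1/\<epsilon>\<^sup>2)\<close> samples and split it at level \<open>1/K\<close>, with \<open>K = min m ((\<sigma>/\<epsilon>)\<^bsup>2/3\<^esup>)\<close>, into at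
  most \<open>K\<close> heavy points and a light part of squared 2-norm at most \<open>1/K\<close>.

  Heavy points are announced by their hash values. If \<open>v = A q\<close> with \<open>\<parallel>q\<parallel> \<le> 1\<close>, then only
  \<open>\<sigma>\<^sup>2/\<epsilon>\<^sup>2\<close> entries of \<open>v\<close> exceed \<open>\<epsilon>\<close>, so \<open>O(log (m \<sigma>/\<epsilon>))\<close> bits identify a heavy point among
  those that matter, independently of \<open>n\<close>. The light-light part is estimated from \<open>O(K)\<close> random sign
  sketches with standard deviation at most about \<open>\<sigma>/K / sqrt K \<le> \<epsilon>\<close>.

  When \<open>\<sigma>\<close> is large compared with \<open>1/\<epsilon>\<close>, \<open>K = m\<close> and there is no light part; the cost
  \<open>O(1/\<epsilon>\<^sup>2)\<close> times \<open>log (\<sigma>/\<epsilon>)\<close> is then absorbed by \<open>(\<sigma>/\<epsilon>)\<^bsup>2/3\<^esup>\<close>, so that no logarithm of \<open>\<sigma>\<close>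
  survives in the bound.\<close>

section \<open>Averages of independent samples\<close>

text \<open>The exponent comes from spending equally many messages on heavy points and on sketches.
  One sketch has variance at most \<open>2 * U * W\<close>, where \<open>U\<close> is at most
  \<open>1/K\<close> (Alice's light part) and \<open>W\<close> at most \<sigma>^2/K (the matrix
  applied to Bob's). Averaging \<open>k\<close> of them leaves 2 \<sigma>^2 / (k K^2), and with
  \<open>k\<close> proportional to \<open>K\<close> this is of order \<epsilon>^2 once K^3 reaches
  (\<sigma>/\<epsilon>)^2. Short hashes suffice because the receiver knows the whole vector against
  which a heavy point is evaluated. Points where that vector is small may be decoded as 0, at a
  total cost of order \<epsilon>, since the weights sum to at most 1. Heavy-heavy pairs must be
  counted once, so the split is asymmetric: Alice's heavy part meets all of Bob's sample, Bob's
  heavy part meets only Alice's light part. The budget is nine errors of \<epsilon>/9 (two grid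
  approximations, two samplings, two decodings, the sketches, two rounded announcements) and five
  failure events of probability 1/15 (two samplings, two hash separations, the sketches).\<close>

lemma expectation_replicate_pmf_Suc:
  fixes h :: "'a list \<Rightarrow> real"
  assumes "finite (set_pmf D)"
  shows "measure_pmf.expectation (replicate_pmf (Suc n) D) h =
    (\<Sum>x\<in>set_pmf D. pmf D x * measure_pmf.expectation (replicate_pmf n D) (\<lambda>xs. h (x # xs)))"
proof -
  have fin: "finite (set_pmf (replicate_pmf n D))"
    using finite_lists_length_eq[OF assms, of n]
    by (simp add: set_replicate_pmf lists_eq_set)
  have "measure_pmf.expectation (replicate_pmf (Suc n) D) h =
    (\<Sum>x\<in>set_pmf D. pmf D x *\<^sub>R measure_pmf.expectation
       (replicate_pmf n D \<bind> (\<lambda>xs. return_pmf (x # xs))) h)"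
    unfolding replicate_pmf.simps using assms fin
    by (intro pmf_expectation_bind) auto
  then show ?thesis
    by (simp flip: map_pmf_def)
qed

text \<open>The cross term of the square vanishes because the sum over the tail of the list has mean
  zero, so both moments go through a single induction.\<close>

lemma replicate_pmf_sum_moments:
  fixes Y :: "'a \<Rightarrow> real"
  assumes fin: "finite (set_pmf D)" and mean: "measure_pmf.expectation D Y = 0"
  shows "measure_pmf.expectation (replicate_pmf n D) (\<lambda>xs. sum_list (map Y xs)) = 0 \<and>
    measure_pmf.expectation (replicate_pmf n D) (\<lambda>xs. (sum_list (map Y xs))\<^sup>2) =
      n * measure_pmf.expectation D (\<lambda>x. (Y x)\<^sup>2)"
proof (induction n)
  case 0
  then show ?case by simp
next
  case (Suc n)
  let ?R = "replicate_pmf n D"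
  have finR: "finite (set_pmf ?R)"
    using finite_lists_length_eq[OF fin, of n]
    by (simp add: set_replicate_pmf lists_eq_set)
  note int = integrable_measure_pmf_finite[OF finR]
  have E: "measure_pmf.expectation D g = (\<Sum>x\<in>set_pmf D. pmf D x * g x)" for g :: "'a \<Rightarrow> real"
    using fin by (simp add: integral_measure_pmf[of "set_pmf D"])
  have one: "(\<Sum>x\<in>set_pmf D. pmf D x) = 1"
    using fin by (simp add: sum_pmf_eq_1)
  have mean': "(\<Sum>x\<in>set_pmf D. pmf D x * Y x) = 0"
    using mean by (simp add: E)
  have "measure_pmf.expectation ?R (\<lambda>xs. Y x + sum_list (map Y xs)) = Y x" for x
    using Suc by (simp add: int)
  moreover have "measure_pmf.expectation ?R (\<lambda>xs. (Y x + sum_list (map Y xs))\<^sup>2) =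
      (Y x)\<^sup>2 + n * measure_pmf.expectation D (\<lambda>x. (Y x)\<^sup>2)" for x
    using Suc by (simp add: int power2_sum)
  ultimately show ?case
    using fin mean' one
    by (simp add: expectation_replicate_pmf_Suc distrib_left sum.distrib E flip: sum_distrib_right del: replicate_pmf.simps)
       (simp add: algebra_simps)
qed

text \<open>Chebyshev's inequality for an average of \<open>k\<close> independent copies. It serves
  both the samples from the inputs and the sign sketches.\<close>

lemma sample_mean_deviation:
  fixes Y :: "'a \<Rightarrow> real"
  assumes fin: "finite (set_pmf D)" and k: "k > 0" and t: "t > 0"
    and V: "measure_pmf.expectation D (\<lambda>x. (Y x - measure_pmf.expectation D Y)\<^sup>2) \<le> V"
  shows "measure_pmf.prob (replicate_pmf k D)
    {xs. \<bar>sum_list (map Y xs) / k - measure_pmf.expectation D Y\<bar> > t} \<le> V / (k * t\<^sup>2)"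
proof -
  let ?R = "replicate_pmf k D"
  define \<mu> where "\<mu> = measure_pmf.expectation D Y"
  define S where "S xs = (\<Sum>x\<leftarrow>xs. Y x - \<mu>)" for xs
  have finR: "finite (set_pmf ?R)"
    using finite_lists_length_eq[OF fin, of k]
    by (simp add: set_replicate_pmf lists_eq_set)
  note int = integrable_measure_pmf_finite[OF finR]
  have "measure_pmf.expectation D (\<lambda>x. Y x - \<mu>) = 0"
    by (simp add: \<mu>_def integrable_measure_pmf_finite[OF fin])
  from replicate_pmf_sum_moments[OF fin this, of k]
  have S2: "measure_pmf.expectation ?R (\<lambda>xs. (S xs)\<^sup>2) \<le> k * V"
    using V unfolding S_def \<mu>_def by (simp add: mult_left_mono)
  have Slen: "S xs = sum_list (map Y xs) - k * \<mu>" if "length xs = k" for xs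
    using that unfolding S_def by (simp add: sum_list_subtractf sum_list_triv)
  \<comment> \<open>\<open>S xs\<close> is the centred sum only for lists of length
    \<open>k\<close>, so the two events are compared on the support alone.\<close>
  have "measure_pmf.prob ?R {xs. \<bar>sum_list (map Y xs) / k - \<mu>\<bar> > t}
      \<le> measure_pmf.prob ?R {xs\<in>space (measure_pmf ?R). (S xs)\<^sup>2 \<ge> (real k * t)\<^sup>2}"
  proof (rule measure_pmf.finite_measure_mono_AE)
    show "AE xs in ?R. xs \<in> {xs. \<bar>sum_list (map Y xs) / k - \<mu>\<bar> > t}
        \<longrightarrow> xs \<in> {xs\<in>space (measure_pmf ?R). (S xs)\<^sup>2 \<ge> (real k * t)\<^sup>2}"
    proof (rule AE_pmfI, safe)
      fix xs assume xs: "xs \<in> set_pmf ?R" and dev: "t < \<bar>sum_list (map Y xs) / k - \<mu>\<bar>"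
      have "sum_list (map Y xs) / k - \<mu> = S xs / k"
        using xs k by (subst Slen) (auto simp: set_replicate_pmf field_simps)
      then have "k * t \<le> \<bar>S xs\<bar>"
        using dev k by (simp add: field_simps)
      then show "(k * t)\<^sup>2 \<le> (S xs)\<^sup>2"
        using k t by (metis abs_le_square_iff abs_of_nonneg mult_nonneg_nonneg of_nat_0_le_iff less_imp_le)
    qed auto
  qed auto
  also have "\<dots> \<le> measure_pmf.expectation ?R (\<lambda>xs. (S xs)\<^sup>2) / (k * t)\<^sup>2"
    using k t int by (intro integral_Markov_inequality_measure[where A="{}"]) auto
  also have "\<dots> \<le> (k * V) / (k * t)\<^sup>2"
    using S2 by (intro divide_right_mono) auto
  also have "\<dots> = V / (k * t\<^sup>2)"
    using k by (simp add: power2_eq_square field_simps)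
  finally show ?thesis unfolding \<mu>_def .
qed

text \<open>Fubini: a failure bound uniform in the earlier randomness survives averaging over it.
  Hashes and signs can thus be analysed with the samples held fixed.\<close>

lemma prob_pair_pmf_le:
  assumes "\<And>a. a \<in> set_pmf A \<Longrightarrow> measure_pmf.prob B {b. Q a b} \<le> \<delta>"
  shows "measure_pmf.prob (pair_pmf A B) {(a, b). Q a b} \<le> \<delta>"
proof -
  obtain a0 where "a0 \<in> set_pmf A"
    by (meson ex_in_conv set_pmf_not_empty)
  then have \<delta>: "\<delta> \<ge> 0"
    using assms measure_nonneg order_trans by blast
  have "emeasure (pair_pmf A B) {(a, b). Q a b} = (\<integral>\<^sup>+a. emeasure B {b. Q a b} \<partial>A)"
    unfolding pair_pmf_def by (simp add: vimage_def flip: map_pmf_def)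
  also have "\<dots> \<le> (\<integral>\<^sup>+a. ennreal \<delta> \<partial>A)"
    using assms by (intro nn_integral_mono_AE AE_pmfI)
      (simp add: measure_pmf.emeasure_eq_measure ennreal_leI)
  finally show ?thesis
    using \<delta> by (simp add: measure_pmf.emeasure_eq_measure)
qed

lemma prob_pair_pmf_fst:
  "measure_pmf.prob (pair_pmf A B) {(a, b). Q a} = measure_pmf.prob A {a. Q a}"
proof -
  have "measure_pmf.prob A {a. Q a} = measure_pmf.prob (map_pmf fst (pair_pmf A B)) {a. Q a}"
    by (simp only: map_fst_pair_pmf)
  also have "\<dots> = measure_pmf.prob (pair_pmf A B) (fst -` {a. Q a})"
    by (rule measure_map_pmf)
  also have "fst -` {a. Q a} = {(a, b). Q a}" by auto
  finally show ?thesis by simp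
qed

lemma expectation_pair_pmf_finite:
  fixes f :: "'a \<Rightarrow> 'b \<Rightarrow> real"
  assumes "finite X" "set_pmf p \<subseteq> X" "finite Y" "set_pmf q \<subseteq> Y"
  shows "measure_pmf.expectation (pair_pmf p q) (\<lambda>(x, y). f x y)
    = (\<Sum>x\<in>X. pmf p x * (\<Sum>y\<in>Y. pmf q y * f x y))"
proof -
  have "measure_pmf.expectation (pair_pmf p q) (\<lambda>(x, y). f x y)
      = (\<Sum>z\<in>X \<times> Y. pmf (pair_pmf p q) z *\<^sub>R (case z of (x, y) \<Rightarrow> f x y))"
    using assms by (intro integral_measure_pmf) auto
  also have "\<dots> = (\<Sum>x\<in>X. \<Sum>y\<in>Y. pmf p x * (pmf q y * f x y))"
    unfolding sum.cartesian_product by (intro sum.cong refl) (auto simp: pmf_pair)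
  finally show ?thesis by (simp add: sum_distrib_left)
qed

section \<open>Hashing\<close>

text \<open>Overwriting the value at \<open>x\<close> by each of the \<open>M\<close> values maps
  the colliding functions injectively into all functions: the overwritten value can still be read
  off at \<open>y\<close>.\<close>

lemma hash_collision_prob:
  assumes X: "finite X" "x \<in> X" "y \<in> X" "x \<noteq> y" and M: "M > 0"
  shows "measure_pmf.prob (pmf_of_set (X \<rightarrow>\<^sub>E {..<M})) {h. h x = h y} \<le> 1 / real M"
proof -
  let ?S = "X \<rightarrow>\<^sub>E {..<M}"
  let ?C = "?S \<inter> {h. h x = h y}"
  have fin: "finite ?S" and ne: "?S \<noteq> {}"
    using X M by (auto intro: finite_PiE simp: PiE_eq_empty_iff)
  have "inj_on (\<lambda>(h, b). h(x := b)) (?C \<times> {..<M})"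
  proof (rule inj_onI, clarify)
    fix h b h' b'
    assume h: "h x = h y" "h' x = h' y" and eq: "h(x := b) = h'(x := b')"
    from eq have "b = b'" by (metis fun_upd_same)
    moreover have "h z = h' z" for z
      using fun_cong[OF eq, of z] fun_cong[OF eq, of y] h X(4) by (cases "z = x") auto
    ultimately show "h = h' \<and> b = b'" by auto
  qed
  moreover have "(\<lambda>(h, b). h(x := b)) ` (?C \<times> {..<M}) \<subseteq> ?S"
    using X by (fastforce simp: PiE_iff extensional_def)
  ultimately have "card (?C \<times> {..<M}) \<le> card ?S"
    using fin card_inj_on_le by blast
  then have le: "real (card ?C) * M \<le> card ?S"
    by (simp add: card_cartesian_product flip: of_nat_mult)
  have pos: "card ?S > 0"
    using fin ne by (simp add: card_gt_0_iff)
  show ?thesis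
    using le pos M by (simp add: measure_pmf_of_set[OF ne fin] field_simps)
qed

text \<open>A union bound over pairs. The size of \<open>X\<close> does not enter, so the range can
  be chosen from the number of heavy points and of relevant candidates only.\<close>

lemma hash_separates_prob:
  assumes X: "finite X" "H \<subseteq> X" "T \<subseteq> X" and M: "M > 0"
  shows "measure_pmf.prob (pmf_of_set (X \<rightarrow>\<^sub>E {..<M})) {h. \<exists>x\<in>H. \<exists>y\<in>T. x \<noteq> y \<and> h x = h y}
    \<le> real (card H) * real (card T) / real M"
proof -
  let ?P = "measure_pmf.prob (pmf_of_set (X \<rightarrow>\<^sub>E {..<M}))"
  let ?B = "\<lambda>(x, y). {h. x \<noteq> y \<and> h x = h y}"
  have fin: "finite H" "finite T"
    using X finite_subset by auto
  have "?P {h. \<exists>x\<in>H. \<exists>y\<in>T. x \<noteq> y \<and> h x = h y} = ?P (\<Union>z\<in>H \<times> T. ?B z)"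
    by (rule arg_cong[where f="?P"]) auto
  also have "\<dots> \<le> (\<Sum>z\<in>H \<times> T. ?P (?B z))"
    using fin by (intro measure_pmf.finite_measure_subadditive_finite) auto
  also have "\<dots> \<le> (\<Sum>z\<in>H \<times> T. 1 / real M)"
  proof (rule sum_mono, clarify)
    fix x y assume "x \<in> H" "y \<in> T"
    then show "?P {h. x \<noteq> y \<and> h x = h y} \<le> 1 / real M"
      using hash_collision_prob[OF X(1) _ _ _ M, of x y] X by (cases "x = y") auto
  qed
  finally show ?thesis
    by (simp add: card_cartesian_product)
qed

definition hashed :: "('a \<Rightarrow> nat) \<Rightarrow> ('a \<Rightarrow> nat) \<Rightarrow> 'a list \<Rightarrow> (nat \<times> nat) list" where
  "hashed h c hs = map (\<lambda>x. (h x, c x)) hs"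

text \<open>The receiver does not invert the hash: each weight is credited to every candidate in
  \<open>T\<close> with that hash value. Under separation there is at most one.\<close>

definition unhash_sum :: "('a \<Rightarrow> nat) \<Rightarrow> 'a set \<Rightarrow> ('a \<Rightarrow> real) \<Rightarrow> (nat \<times> nat) list \<Rightarrow> real" where
  "unhash_sum h T v l = (\<Sum>(b, c)\<leftarrow>l. real c * (\<Sum>y\<in>{y\<in>T. h y = b}. v y))"

text \<open>Under separation a point of \<open>T\<close> is decoded exactly, and any other point is
  read as having value 0, which is off by at most \<open>e\<close> per unit of weight.\<close>

lemma unhash_sum_hashed:
  assumes X: "finite X" "set hs \<subseteq> X" "distinct hs"
    and T: "T = {x\<in>X. \<bar>v x\<bar> > e}" and e: "e \<ge> 0"
    and sep: "\<not> (\<exists>x\<in>set hs. \<exists>y\<in>T. x \<noteq> y \<and> h x = h y)"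
  shows "\<bar>unhash_sum h T v (hashed h c hs) - (\<Sum>x\<in>set hs. c x * v x)\<bar> \<le> e * (\<Sum>x\<in>set hs. c x)"
proof -
  have "unhash_sum h T v (hashed h c hs)
      = (\<Sum>x\<in>set hs. real (c x) * (\<Sum>y\<in>{y\<in>T. h y = h x}. v y))"
    using X(3) by (simp add: unhash_sum_def hashed_def comp_def sum_list_distinct_conv_sum_set)
  also have "\<dots> = (\<Sum>x\<in>set hs. c x * (if x \<in> T then v x else 0))"
  proof (rule sum.cong[OF refl])
    fix x assume x: "x \<in> set hs"
    have "y = x" if "y \<in> T" "h y = h x" for y
      using sep x that by metis
    then have "{y\<in>T. h y = h x} = (if x \<in> T then {x} else {})"
      by auto
    then show "real (c x) * (\<Sum>y\<in>{y\<in>T. h y = h x}. v y) = c x * (if x \<in> T then v x else 0)"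
      by simp
  qed
  finally have "unhash_sum h T v (hashed h c hs) - (\<Sum>x\<in>set hs. c x * v x)
      = (\<Sum>x\<in>set hs. c x * ((if x \<in> T then v x else 0) - v x))"
    by (simp add: right_diff_distrib sum_subtractf)
  also have "\<bar>\<dots>\<bar> \<le> (\<Sum>x\<in>set hs. c x * e)"
  proof (rule order_trans[OF sum_abs], rule sum_mono)
    fix x assume x: "x \<in> set hs"
    then have "\<bar>(if x \<in> T then v x else 0) - v x\<bar> \<le> e"
      using X T e by auto
    then show "\<bar>c x * ((if x \<in> T then v x else 0) - v x)\<bar> \<le> c x * e"
      by (simp add: abs_mult mult_left_mono)
  qed
  finally show ?thesis
    by (simp add: sum_distrib_left mult.commute)
qed

section \<open>Random signs\<close>

text \<open>Negating the sign at \<open>z\<close> is an involution of the sign functions, so a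
  function odd in that coordinate has a sum equal to its own negative.\<close>

lemma sum_sign_flip_eq_0:
  fixes F :: "('a \<Rightarrow> real) \<Rightarrow> real"
  assumes z: "z \<in> X" and F: "\<And>g. F (g(z := - g z)) = - F g"
  shows "(\<Sum>g\<in>X \<rightarrow>\<^sub>E {-1, 1}. F g) = 0"
proof -
  have mem: "g(z := - g z) \<in> X \<rightarrow>\<^sub>E {-1, 1}" if "g \<in> X \<rightarrow>\<^sub>E {-1, 1}" for g :: "'a \<Rightarrow> real"
    using that z by (fastforce simp: PiE_iff extensional_def)
  have "(\<Sum>g\<in>X \<rightarrow>\<^sub>E {-1, 1}. F g) = (\<Sum>g\<in>X \<rightarrow>\<^sub>E {-1, 1}. - F g)"
    by (rule sum.reindex_bij_witness[where i="\<lambda>g. g(z := - g z)" and j="\<lambda>g. g(z := - g z)"])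
       (auto simp: mem F)
  then show ?thesis by (simp add: sum_negf)
qed

text \<open>Unless the two pairs agree as sets, \<open>x\<close> or \<open>y\<close> occurs exactly
  once among the four factors, and flipping its sign cancels the sum.\<close>

lemma sum_sign_products:
  fixes X :: "'a set"
  assumes X: "x \<in> X" "y \<in> X" "a \<in> X" "b \<in> X" and ne: "x \<noteq> y" "a \<noteq> b"
  shows "(\<Sum>g\<in>X \<rightarrow>\<^sub>E {-1, 1::real}. g x * g y * (g a * g b)) =
    (if (a, b) = (x, y) \<or> (a, b) = (y, x) then real (card (X \<rightarrow>\<^sub>E {-1, 1::real})) else 0)"
proof (cases "(a, b) = (x, y) \<or> (a, b) = (y, x)")
  case True
  have "g x * g y * (g a * g b) = 1" if "g \<in> X \<rightarrow>\<^sub>E {-1, 1}" for g :: "'a \<Rightarrow> real"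
  proof -
    have "g x \<in> {-1, 1}" "g y \<in> {-1, 1}" using that X by auto
    then show ?thesis using True by auto
  qed
  then show ?thesis using True by simp
next
  case False
  then consider "x \<noteq> a \<and> x \<noteq> b" | "y \<noteq> a \<and> y \<noteq> b"
    using ne by auto
  then have "(\<Sum>g\<in>X \<rightarrow>\<^sub>E {-1, 1::real}. g x * g y * (g a * g b)) = 0"
  proof cases
    case 1
    with X ne show ?thesis by (intro sum_sign_flip_eq_0[of x]) auto
  next
    case 2
    with X ne show ?thesis by (intro sum_sign_flip_eq_0[of y]) auto
  qed
  then show ?thesis using False by auto
qed

text \<open>The tug-of-war sketch of an inner product. Diagonal terms are constant because signs
  square to 1; off-diagonal monomials are orthogonal except to themselves and their swaps, which is
  the source of the factor 2.\<close>

lemma sign_sketch_moments: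
  fixes u w :: "'a \<Rightarrow> real"
  assumes X: "finite X"
  defines "Z \<equiv> \<lambda>g. (\<Sum>x\<in>X. u x * g x) * (\<Sum>x\<in>X. w x * g x)"
    and "D \<equiv> pmf_of_set (X \<rightarrow>\<^sub>E {-1, 1::real})"
  shows "measure_pmf.expectation D Z = (\<Sum>x\<in>X. u x * w x)"
    and "measure_pmf.expectation D (\<lambda>g. (Z g - (\<Sum>x\<in>X. u x * w x))\<^sup>2)
      \<le> 2 * (\<Sum>x\<in>X. (u x)\<^sup>2) * (\<Sum>x\<in>X. (w x)\<^sup>2)"
proof -
  let ?G = "X \<rightarrow>\<^sub>E {-1, 1::real}"
  define Off where "Off = {q\<in>X \<times> X. fst q \<noteq> snd q}"
  define c where "c q = u (fst q) * w (snd q)" for q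
  define s where "s q g = g (fst q) * g (snd q)" for q and g :: "'a \<Rightarrow> real"
  have finO: "finite Off" using X by (simp add: Off_def)
  have fin: "finite ?G" and ne: "?G \<noteq> {}"
    using X by (auto intro: finite_PiE simp: PiE_eq_empty_iff)
  have pos: "card ?G > 0" using fin ne by (simp add: card_gt_0_iff)
  have Exp: "measure_pmf.expectation D F = (\<Sum>g\<in>?G. F g) / card ?G" for F :: "_ \<Rightarrow> real"
    unfolding D_def using fin ne by (simp add: integral_pmf_of_set)
  have Z: "Z g = (\<Sum>x\<in>X. u x * w x) + (\<Sum>q\<in>Off. c q * s q g)" if g: "g \<in> ?G" for g
  proof -
    have "Z g = (\<Sum>q\<in>X \<times> X. c q * s q g)"
      by (simp add: Z_def sum_product sum.cartesian_product c_def s_def case_prod_unfold mult_ac)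
    also have "X \<times> X = (\<lambda>x. (x, x)) ` X \<union> Off"
      by (auto simp: Off_def)
    also have "(\<Sum>q\<in>(\<lambda>x. (x, x)) ` X \<union> Off. c q * s q g)
        = (\<Sum>q\<in>(\<lambda>x. (x, x)) ` X. c q * s q g) + (\<Sum>q\<in>Off. c q * s q g)"
      using X finO by (intro sum.union_disjoint) (auto simp: Off_def)
    also have "(\<Sum>q\<in>(\<lambda>x. (x, x)) ` X. c q * s q g) = (\<Sum>x\<in>X. u x * w x)"
    proof (subst sum.reindex)
      show "sum ((\<lambda>q. c q * s q g) \<circ> (\<lambda>x. (x, x))) X = (\<Sum>x\<in>X. u x * w x)"
      proof (rule sum.cong[OF refl])
        fix x assume "x \<in> X"
        then have "g x \<in> {-1, 1}" using g by auto
        then show "((\<lambda>q. c q * s q g) \<circ> (\<lambda>x. (x, x))) x = u x * w x"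
          by (auto simp: c_def s_def)
      qed
    qed (auto simp: inj_on_def)
    finally show ?thesis .
  qed
  have s0: "(\<Sum>g\<in>?G. s q g) = 0" if "q \<in> Off" for q
    unfolding s_def using that by (intro sum_sign_flip_eq_0[of "fst q"]) (auto simp: Off_def)
  have "(\<Sum>g\<in>?G. \<Sum>q\<in>Off. c q * s q g) = 0"
    by (subst sum.swap) (simp add: s0 flip: sum_distrib_left)
  then have "(\<Sum>g\<in>?G. Z g) = card ?G * (\<Sum>x\<in>X. u x * w x)"
    by (simp add: Z sum.distrib)
  then show "measure_pmf.expectation D Z = (\<Sum>x\<in>X. u x * w x)"
    using pos by (simp add: Exp)
  have inner: "(\<Sum>r\<in>Off. c r * (\<Sum>g\<in>?G. s q g * s r g)) = card ?G * (c q + c (prod.swap q))"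
    if q: "q \<in> Off" for q
  proof -
    have sw: "prod.swap q \<in> Off" "prod.swap q \<noteq> q"
      using q by (auto simp: Off_def prod_eq_iff)
    have "(\<Sum>r\<in>Off. c r * (\<Sum>g\<in>?G. s q g * s r g))
        = (\<Sum>r\<in>Off. if r \<in> {q, prod.swap q} then c r * card ?G else 0)"
    proof (rule sum.cong[OF refl])
      fix r assume "r \<in> Off"
      with q show "c r * (\<Sum>g\<in>?G. s q g * s r g) = (if r \<in> {q, prod.swap q} then c r * card ?G else 0)"
        unfolding s_def
        by (subst sum_sign_products) (auto simp: Off_def prod_eq_iff)
    qed
    also have "\<dots> = (\<Sum>r\<in>{q, prod.swap q}. c r * card ?G)"
      using finO q sw by (subst sum.inter_restrict[symmetric]) (auto intro!: sum.cong)
    also have "\<dots> = card ?G * (c q + c (prod.swap q))"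
      using sw by (simp add: algebra_simps)
    finally show ?thesis .
  qed
  have swap_sum: "(\<Sum>q\<in>Off. (c (prod.swap q))\<^sup>2) = (\<Sum>q\<in>Off. (c q)\<^sup>2)"
    by (rule sum.reindex_bij_witness[where i=prod.swap and j=prod.swap]) (auto simp: Off_def)
  have "(\<Sum>g\<in>?G. (\<Sum>q\<in>Off. c q * s q g)\<^sup>2)
      = (\<Sum>g\<in>?G. \<Sum>q\<in>Off. \<Sum>r\<in>Off. c q * (c r * (s q g * s r g)))"
    by (simp add: power2_eq_square sum_product mult_ac)
  also have "\<dots> = (\<Sum>q\<in>Off. \<Sum>g\<in>?G. \<Sum>r\<in>Off. c q * (c r * (s q g * s r g)))"
    by (rule sum.swap)
  also have "\<dots> = (\<Sum>q\<in>Off. \<Sum>r\<in>Off. \<Sum>g\<in>?G. c q * (c r * (s q g * s r g)))"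
    by (intro sum.cong refl sum.swap)
  also have "\<dots> = (\<Sum>q\<in>Off. c q * (card ?G * (c q + c (prod.swap q))))"
    by (rule sum.cong[OF refl]) (simp add: inner flip: sum_distrib_left)
  also have "\<dots> = card ?G * (\<Sum>q\<in>Off. c q * (c q + c (prod.swap q)))"
    by (simp add: sum_distrib_left mult_ac)
  \<comment> \<open>The product of \<open>c q\<close> with its swap is at most half the sum of their
    squares; as \<open>Off\<close> is invariant under swapping, the weights 3/2 and 1/2 add up to
    2.\<close>
  also have "(\<Sum>q\<in>Off. c q * (c q + c (prod.swap q)))
      \<le> (\<Sum>q\<in>Off. 3/2 * (c q)\<^sup>2 + 1/2 * (c (prod.swap q))\<^sup>2)"
  proof (rule sum_mono)
    fix q
    show "c q * (c q + c (prod.swap q)) \<le> 3/2 * (c q)\<^sup>2 + 1/2 * (c (prod.swap q))\<^sup>2"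
      using zero_le_power2[of "c q - c (prod.swap q)"]
      by (simp add: power2_eq_square algebra_simps)
  qed
  also have "\<dots> = 2 * (\<Sum>q\<in>Off. (c q)\<^sup>2)"
    by (simp only: sum.distrib swap_sum flip: sum_distrib_left)
  also have "(\<Sum>q\<in>Off. (c q)\<^sup>2) \<le> (\<Sum>q\<in>X \<times> X. (c q)\<^sup>2)"
    using X by (intro sum_mono2) (auto simp: Off_def)
  also have "\<dots> = (\<Sum>x\<in>X. (u x)\<^sup>2) * (\<Sum>x\<in>X. (w x)\<^sup>2)"
    by (simp add: sum_product sum.cartesian_product c_def case_prod_unfold power_mult_distrib)
  finally have "(\<Sum>g\<in>?G. (\<Sum>q\<in>Off. c q * s q g)\<^sup>2)
      \<le> card ?G * (2 * ((\<Sum>x\<in>X. (u x)\<^sup>2) * (\<Sum>x\<in>X. (w x)\<^sup>2)))"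
    by (simp add: mult_left_mono)
  then show "measure_pmf.expectation D (\<lambda>g. (Z g - (\<Sum>x\<in>X. u x * w x))\<^sup>2)
      \<le> 2 * (\<Sum>x\<in>X. (u x)\<^sup>2) * (\<Sum>x\<in>X. (w x)\<^sup>2)"
    using pos by (simp add: Exp Z field_simps)
qed

section \<open>Sampling from a grid\<close>

text \<open>The shared randomness is a discrete distribution that does not depend on the inputs, so a
  sample from \<open>p\<close> has to be a function of \<open>p\<close> and of a uniform element of a fixed finite grid.\<close>

lemma pmf_grid_approx:
  fixes N :: nat
  assumes X: "finite X" "set_pmf p \<subseteq> X" and N: "N > 0"
  shows "\<exists>\<phi>. (\<forall>r. \<phi> r \<in> X) \<and> (\<forall>v. (\<forall>x\<in>X. \<bar>v x\<bar> \<le> 1) \<longrightarrow>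
    \<bar>(\<Sum>r<N. v (\<phi> r)) / N - (\<Sum>x\<in>X. pmf p x * v x)\<bar> \<le> 2 * real (card X) / N)"
proof -
  obtain x0 where x0: "x0 \<in> X"
    using X(2) set_pmf_not_empty[of p] by blast
  \<comment> \<open>Point \<open>x\<close> receives \<open>c x\<close> grid cells, at most one short
    of \<open>N * pmf p x\<close>, and the at most \<open>card X\<close> leftover cells all go to
    \<open>x0\<close>. Each of the two defects contributes one \<open>card X\<close> to the
    bound.\<close>
  define c where "c x = nat \<lfloor>N * pmf p x\<rfloor>" for x
  have c: "real (c x) \<le> N * pmf p x" "N * pmf p x - 1 \<le> real (c x)" for x
    unfolding c_def by (simp_all add: of_nat_nat)
  define S where "S = Sigma X (\<lambda>x. {..<c x})"
  have finS: "finite S" using X by (simp add: S_def)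
  have one: "(\<Sum>x\<in>X. pmf p x) = 1"
    using X by (simp add: sum_pmf_eq_1)
  have cardS: "real (card S) = (\<Sum>x\<in>X. real (c x))"
    using X by (simp add: S_def)
  have "real (card S) \<le> (\<Sum>x\<in>X. N * pmf p x)"
    unfolding cardS by (intro sum_mono c)
  then have S_le: "card S \<le> N"
    using one by (simp flip: sum_distrib_left)
  have "(\<Sum>x\<in>X. N * pmf p x - 1) \<le> real (card S)"
    unfolding cardS by (intro sum_mono c)
  then have S_ge: "real N - card S \<le> card X"
    using one by (simp add: sum_subtractf flip: sum_distrib_left)
  obtain b where b: "bij_betw b {0..<card S} S"
    using ex_bij_betw_nat_finite[OF finS] by blast
  define \<phi> where "\<phi> r = (if r < card S then fst (b r) else x0)" for r
  have "b r \<in> S" if "r < card S" for r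
    using bij_betwE[OF b] that by simp
  then have "\<phi> r \<in> X" for r
    using x0 unfolding \<phi>_def S_def by (metis SigmaD1 prod.collapse)
  moreover have "\<bar>(\<Sum>r<N. v (\<phi> r)) / N - (\<Sum>x\<in>X. pmf p x * v x)\<bar> \<le> 2 * real (card X) / N"
    if v: "\<forall>x\<in>X. \<bar>v x\<bar> \<le> 1" for v
  proof -
    have "(\<Sum>r<N. v (\<phi> r)) = (\<Sum>r\<in>{0..<card S}. v (\<phi> r)) + (\<Sum>r\<in>{card S..<N}. v (\<phi> r))"
      using S_le by (simp add: sum.atLeastLessThan_concat flip: atLeast0LessThan)
    also have "(\<Sum>r\<in>{card S..<N}. v (\<phi> r)) = (real N - card S) * v x0"
      using S_le by (simp add: \<phi>_def of_nat_diff)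
    also have "(\<Sum>r\<in>{0..<card S}. v (\<phi> r)) = (\<Sum>q\<in>S. v (fst q))"
      using sum.reindex_bij_betw[OF b, of "\<lambda>q. v (fst q)"] by (simp add: \<phi>_def)
    also have "\<dots> = (\<Sum>x\<in>X. c x * v x)"
      unfolding S_def using X by (subst sum.Sigma[symmetric, where g="\<lambda>x i. v x", unfolded split_beta]) auto
    finally have "(\<Sum>r<N. v (\<phi> r)) - N * (\<Sum>x\<in>X. pmf p x * v x)
        = (\<Sum>x\<in>X. (c x - N * pmf p x) * v x) + (real N - card S) * v x0"
      by (simp add: left_diff_distrib sum_subtractf sum_distrib_left mult.assoc)
    also have "\<bar>\<dots>\<bar> \<le> real (card X) + real (card X)"
    proof (rule order_trans[OF abs_triangle_ineq], rule add_mono)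
      have "\<bar>\<Sum>x\<in>X. (c x - N * pmf p x) * v x\<bar> \<le> (\<Sum>x\<in>X. 1)"
      proof (rule order_trans[OF sum_abs], rule sum_mono)
        fix x assume "x \<in> X"
        have "\<bar>c x - N * pmf p x\<bar> \<le> 1" using c[of x] by linarith
        then show "\<bar>(c x - N * pmf p x) * v x\<bar> \<le> 1"
          using v \<open>x \<in> X\<close> by (simp add: abs_mult mult_le_one)
      qed
      then show "\<bar>\<Sum>x\<in>X. (c x - N * pmf p x) * v x\<bar> \<le> card X" by simp
      have "\<bar>(real N - card S) * v x0\<bar> \<le> (real N - card S) * 1"
        using S_le v x0 unfolding abs_mult by (intro mult_mono) auto
      then show "\<bar>(real N - card S) * v x0\<bar> \<le> card X"
        using S_ge by simp
    qed
    finally have d: "\<bar>(\<Sum>r<N. v (\<phi> r)) - N * (\<Sum>x\<in>X. pmf p x * v x)\<bar> \<le> 2 * card X" by simp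
    have "(\<Sum>r<N. v (\<phi> r)) / N - (\<Sum>x\<in>X. pmf p x * v x)
        = ((\<Sum>r<N. v (\<phi> r)) - N * (\<Sum>x\<in>X. pmf p x * v x)) / N"
      using N by (simp add: field_simps)
    then show ?thesis
      using d N by (simp add: divide_right_mono)
  qed
  ultimately show ?thesis by blast
qed

section \<open>Protocols that send messages from a finite set\<close>

text \<open>The message is found by binary search, each bit halving the set of candidates.
  Abstracting the node constructor as \<open>mk\<close> and the speaker's input as
  \<open>sel\<close> lets one induction serve both parties.\<close>

lemma message_protocol:
  fixes mk :: "('m \<Rightarrow> bool) \<Rightarrow> ('a, 'b, 'c) protocol \<Rightarrow> ('a, 'b, 'c) protocol \<Rightarrow> ('a, 'b, 'c) protocol"
    and F :: "'s \<Rightarrow> 'a \<Rightarrow> 'b \<Rightarrow> 'c" and msg :: "'m \<Rightarrow> 's"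
  assumes mk: "\<And>h l r. depth (mk h l r) = Suc (max (depth l) (depth r))"
    "\<And>h l r p q. run (mk h l r) p q = (if h (sel p q) then run l p q else run r p q)"
  assumes S: "finite S" "card S \<le> 2 ^ a"
    and rest: "\<And>s. s \<in> S \<Longrightarrow> \<exists>\<pi>. depth \<pi> \<le> d \<and> (\<forall>p q. run \<pi> p q = F s p q)"
  shows "\<exists>\<pi>. depth \<pi> \<le> a + d \<and>
    (\<forall>p q. msg (sel p q) \<in> S \<longrightarrow> run \<pi> p q = F (msg (sel p q)) p q)"
  using S rest
proof (induction a arbitrary: S)
  case 0
  show ?case
  proof (cases "S = {}")
    case True
    \<comment> \<open>Halving can leave an empty half; no input reaches that subtree, so any leaf
      will do.\<close>
    then show ?thesis by (intro exI[of _ "Output undefined"]) auto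
  next
    case False
    with 0 obtain s where s: "S = {s}"
      by (metis card_0_eq card_1_singletonE le_antisym less_one linorder_not_le power_0)
    with 0 obtain \<pi> where "depth \<pi> \<le> d" "\<forall>p q. run \<pi> p q = F s p q" by blast
    with s show ?thesis by (intro exI[of _ \<pi>]) auto
  qed
next
  case (Suc a)
  obtain S1 where S1: "S1 \<subseteq> S" "card S1 = min (card S) (2 ^ a)"
    by (metis min.cobounded1 obtain_subset_with_card_n)
  have "card (S - S1) \<le> 2 ^ a"
    using Suc.prems S1 by (simp add: card_Diff_subset finite_subset)
  moreover have "card S1 \<le> 2 ^ a" using S1 by simp
  ultimately have
    "\<exists>\<pi>. depth \<pi> \<le> a + d \<and> (\<forall>p q. msg (sel p q) \<in> S1 \<longrightarrow> run \<pi> p q = F (msg (sel p q)) p q)"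
    "\<exists>\<pi>. depth \<pi> \<le> a + d \<and> (\<forall>p q. msg (sel p q) \<in> S - S1 \<longrightarrow> run \<pi> p q = F (msg (sel p q)) p q)"
    using S1 Suc.prems finite_subset[OF S1(1)] by (intro Suc.IH; blast)+
  then obtain l r where
    l: "depth l \<le> a + d" "\<forall>p q. msg (sel p q) \<in> S1 \<longrightarrow> run l p q = F (msg (sel p q)) p q" and
    r: "depth r \<le> a + d" "\<forall>p q. msg (sel p q) \<in> S - S1 \<longrightarrow> run r p q = F (msg (sel p q)) p q"
    by (elim exE conjE)
  show ?case
    using l r by (intro exI[of _ "mk (\<lambda>m. msg m \<in> S1) l r"]) (auto simp: mk)
qed

lemma alice_sends:
  assumes "finite S" "card S \<le> 2 ^ a" "\<And>p. msg p \<in> S"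
    "\<And>s. s \<in> S \<Longrightarrow> \<exists>\<pi>. depth \<pi> \<le> d \<and> (\<forall>p q. run \<pi> p q = F s p q)"
  shows "\<exists>\<pi>. depth \<pi> \<le> a + d \<and> (\<forall>p q. run \<pi> p q = F (msg p) p q)"
  using message_protocol[of Alice "\<lambda>p q. p" S a d F msg] assms by simp

lemma bob_sends:
  assumes "finite S" "card S \<le> 2 ^ a" "\<And>q. msg q \<in> S"
    "\<And>s. s \<in> S \<Longrightarrow> \<exists>\<pi>. depth \<pi> \<le> d \<and> (\<forall>p q. run \<pi> p q = F s p q)"
  shows "\<exists>\<pi>. depth \<pi> \<le> a + d \<and> (\<forall>p q. run \<pi> p q = F (msg q) p q)"
  using message_protocol[of Bob "\<lambda>p q. q" S a d F msg] assms by simp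

section \<open>The largest singular value bounds the bilinear form\<close>

lemma max_rayleigh_quotient:
  fixes a :: "nat \<Rightarrow> nat \<Rightarrow> real"
  assumes N: "N > 0"
  obtains l w where "l \<ge> 0" "\<exists>j<N. w j \<noteq> 0"
    "\<And>j. j < N \<Longrightarrow> (\<Sum>i<N. a i j * (\<Sum>k<N. a i k * w k)) = l * w j"
    "\<And>u. (\<Sum>i<N. (\<Sum>k<N. a i k * u k)\<^sup>2) \<le> l * (\<Sum>k<N. (u k)\<^sup>2)"
proof -
  \<comment> \<open>A maximiser \<open>w\<close> of \<open>B w w\<close> on the unit sphere of \<open>I\<close> is a zero of the positive semidefinite
    form \<open>l * I - B\<close>, hence lies in its kernel.\<close>
  define B where "B u v = (\<Sum>i<N. (\<Sum>k<N. a i k * u k) * (\<Sum>k<N. a i k * v k))" for u v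
  define I where "I u v = (\<Sum>k<N. u k * v k)" for u v :: "nat \<Rightarrow> real"
  \<comment> \<open>Vectors are functions on all of \<open>nat\<close>. Pinning the coordinates from
    \<open>N\<close> on to 0 makes the box a product of compact sets; \<open>u'\<close> below
    applies the same truncation to an arbitrary argument.\<close>
  define Box where "Box = (\<Pi>\<^sub>E i\<in>UNIV. if i < N then {-1..1::real} else {0})"
  define K where "K = Box \<inter> {w. I w w = 1}"
  have cont: "continuous_on UNIV (\<lambda>w::nat \<Rightarrow> real. w k)" for k
    by (rule continuous_on_product_coordinates)
  have contI: "continuous_on UNIV (\<lambda>w. I w w)" and contB: "continuous_on UNIV (\<lambda>w. B w w)"
    unfolding I_def B_def by (intro continuous_intros cont)+
  have "compactin euclidean Box"
    unfolding Box_def euclidean_product_topology[symmetric]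
    by (subst compactin_PiE) auto
  then have "compact Box" by simp
  moreover have "closed {w. I w w = 1}"
    using continuous_closed_preimage[OF contI, of "{1}"] by (simp add: vimage_def)
  ultimately have cK: "compact K"
    unfolding K_def by (rule compact_Int_closed)
  have "(\<lambda>i. if i = 0 then 1 else 0) \<in> K"
    using N by (auto simp: K_def Box_def I_def if_distrib sum.delta cong: if_cong)
  then have neK: "K \<noteq> {}" by blast
  obtain w where w: "w \<in> K" and max: "\<And>u. u \<in> K \<Longrightarrow> B u u \<le> B w w"
    using continuous_attains_sup[OF cK neK continuous_on_subset[OF contB]] by auto
  define l where "l = B w w"
  have Iw: "I w w = 1" using w by (simp add: K_def)
  have l0: "l \<ge> 0"
    unfolding l_def B_def by (intro sum_nonneg) simp
  have scale: "B (\<lambda>k. c * u k) (\<lambda>k. c * u k) = c\<^sup>2 * B u u" "I (\<lambda>k. c * u k) (\<lambda>k. c * u k) = c\<^sup>2 * I u u"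
    for c u
  proof -
    have "(\<Sum>k<N. a i k * (c * u k)) = c * (\<Sum>k<N. a i k * u k)" for i
      by (simp add: sum_distrib_left mult_ac)
    then show "B (\<lambda>k. c * u k) (\<lambda>k. c * u k) = c\<^sup>2 * B u u"
      by (simp add: B_def sum_distrib_left power2_eq_square mult_ac)
    show "I (\<lambda>k. c * u k) (\<lambda>k. c * u k) = c\<^sup>2 * I u u"
      by (simp add: I_def sum_distrib_left power2_eq_square mult_ac)
  qed
  have bound: "B u u \<le> l * I u u" for u
  proof -
    define u' where "u' k = (if k < N then u k else 0)" for k
    have eq: "B u u = B u' u'" "I u u = I u' u'"
      by (simp_all add: B_def I_def u'_def)
    show ?thesis
    proof (cases "I u' u' = 0")
      case True
      then have "u' k = 0" if "k < N" for k
        using that by (simp add: I_def sum_nonneg_eq_0_iff)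
      then have "B u' u' = 0" by (simp add: B_def)
      then show ?thesis using eq True by simp
    next
      case False
      have I0: "I u' u' \<ge> 0" unfolding I_def by (intro sum_nonneg) simp
      define c where "c = 1 / sqrt (I u' u')"
      have c2: "c\<^sup>2 = 1 / I u' u'" using I0 by (simp add: c_def power_divide)
      have one: "I (\<lambda>k. c * u' k) (\<lambda>k. c * u' k) = 1"
        unfolding scale c2 using False by simp
      have "\<bar>c * u' k\<bar> \<le> 1" if "k < N" for k
      proof -
        have "(c * u' k)\<^sup>2 \<le> (\<Sum>k<N. (c * u' k)\<^sup>2)"
          using that by (intro member_le_sum) auto
        also have "\<dots> = 1" using one by (simp add: I_def power2_eq_square)
        finally show ?thesis by (simp add: abs_square_le_1)
      qed
      then have "(\<lambda>k. c * u' k) \<in> Box"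
        unfolding Box_def by (auto simp: PiE_iff u'_def abs_le_iff)
      then have "B (\<lambda>k. c * u' k) (\<lambda>k. c * u' k) \<le> l"
        using one max by (simp add: K_def l_def)
      then have "B u' u' / I u' u' \<le> l" unfolding scale c2 by simp
      then show ?thesis using eq I0 False by (simp add: field_simps)
    qed
  qed
  have lin: "B (\<lambda>k. w k + t * v k) (\<lambda>k. w k + t * v k) = B w w + 2 * t * B w v + t\<^sup>2 * B v v"
    "I (\<lambda>k. w k + t * v k) (\<lambda>k. w k + t * v k) = I w w + 2 * t * I w v + t\<^sup>2 * I v v" for t v
  proof -
    have "(\<Sum>k<N. a i k * (w k + t * v k)) = (\<Sum>k<N. a i k * w k) + t * (\<Sum>k<N. a i k * v k)" for i
      by (simp add: distrib_left sum.distrib sum_distrib_left mult_ac)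
    then have "B (\<lambda>k. w k + t * v k) (\<lambda>k. w k + t * v k) = (\<Sum>i<N.
        (\<Sum>k<N. a i k * w k) * (\<Sum>k<N. a i k * w k) + 2 * t * ((\<Sum>k<N. a i k * w k) * (\<Sum>k<N. a i k * v k))
          + t\<^sup>2 * ((\<Sum>k<N. a i k * v k) * (\<Sum>k<N. a i k * v k)))"
      unfolding B_def by (intro sum.cong refl) (simp add: power2_eq_square algebra_simps)
    then show "B (\<lambda>k. w k + t * v k) (\<lambda>k. w k + t * v k) = B w w + 2 * t * B w v + t\<^sup>2 * B v v"
      by (simp only: B_def sum_distrib_left[symmetric] sum.distrib)
    show "I (\<lambda>k. w k + t * v k) (\<lambda>k. w k + t * v k) = I w w + 2 * t * I w v + t\<^sup>2 * I v v"
      by (simp add: I_def sum_distrib_left power2_eq_square algebra_simps sum.distrib)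
  qed
  have stationary: "B w v = l * I w v" for v
  proof -
    define \<beta> where "\<beta> = l * I w v - B w v"
    define \<gamma> where "\<gamma> = l * I v v - B v v"
    have \<gamma>0: "\<gamma> \<ge> 0" using bound[of v] by (simp add: \<gamma>_def)
    have ineq: "0 \<le> 2 * t * \<beta> + t\<^sup>2 * \<gamma>" for t
      using bound[of "\<lambda>k. w k + t * v k"] unfolding lin \<beta>_def \<gamma>_def Iw l_def[symmetric]
      by (simp add: algebra_simps)
    \<comment> \<open>The minimiser of the quadratic would be \<open>- \<beta> / \<gamma>\<close>.
      The \<open>+ 1\<close> avoids division by zero, and the value is still negative unless
      \<open>\<beta>\<close> is 0.\<close>
    define t where "t = - \<beta> / (\<gamma> + 1)"
    have t: "t * (\<gamma> + 1) = - \<beta>" using \<gamma>0 by (simp add: t_def)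
    have "0 \<le> (2 * t * \<beta> + t\<^sup>2 * \<gamma>) * (\<gamma> + 1)\<^sup>2"
      using ineq[of t] by simp
    also have "\<dots> = 2 * (t * (\<gamma> + 1)) * \<beta> * (\<gamma> + 1) + (t * (\<gamma> + 1))\<^sup>2 * \<gamma>"
      by (simp add: power2_eq_square algebra_simps)
    also have "\<dots> = - (\<beta>\<^sup>2 * (\<gamma> + 2))"
      unfolding t by (simp add: power2_eq_square algebra_simps)
    finally have "\<beta>\<^sup>2 * (\<gamma> + 2) \<le> 0" by simp
    then have "\<beta> = 0"
      using \<gamma>0 by (simp add: mult_le_0_iff)
    then show ?thesis by (simp add: \<beta>_def)
  qed
  have "(\<Sum>i<N. a i j * (\<Sum>k<N. a i k * w k)) = l * w j" if j: "j < N" for j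
    using stationary[of "\<lambda>k. if k = j then 1 else 0"] j
    by (simp add: B_def I_def if_distrib sum.delta mult.commute cong: if_cong)
  moreover have "\<exists>j<N. w j \<noteq> 0"
    using Iw by (auto simp: I_def intro: ccontr)
  moreover have "(\<Sum>i<N. (\<Sum>k<N. a i k * u k)\<^sup>2) \<le> l * (\<Sum>k<N. (u k)\<^sup>2)" for u
    using bound[of u] by (simp add: B_def I_def power2_eq_square)
  ultimately show ?thesis using that l0 by blast
qed

text \<open>Makes \<open>Max\<close> meaningful: the squares of singular values are roots of a
  nonzero characteristic polynomial.\<close>

lemma finite_singular_values:
  assumes "A \<in> carrier_mat r c"
  shows "finite (singular_values A)"
proof -
  let ?B = "transpose_mat A * A"
  have B: "?B \<in> carrier_mat c c" using assms by simp
  have "char_poly ?B \<noteq> 0"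
    using degree_monic_char_poly[OF B] by auto
  then have "finite {x. poly (char_poly ?B) x = 0}"
    by (rule poly_roots_finite)
  then have "finite {x. eigenvalue ?B x}"
    by (simp add: eigenvalue_root_char_poly[OF B])
  then have "finite (sqrt ` {x. eigenvalue ?B x})" by simp
  moreover have "singular_values A \<subseteq> sqrt ` {x. eigenvalue ?B x}"
    unfolding singular_values_def by (force simp: image_iff intro: exI[of _ "_\<^sup>2"])
  ultimately show ?thesis by (rule rev_finite_subset)
qed

lemma cube_enumeration:
  "bij_betw (\<lambda>i. List.n_lists n [False, True] ! i) {..<2 ^ n} (cube n)"
proof -
  have d: "distinct (List.n_lists n [False, True])"
    by (simp add: distinct_n_lists)
  have "set (List.n_lists n [False, True]) = cube n"
    by (auto simp: set_n_lists cube_def)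
  moreover have "length (List.n_lists n [False, True]) = 2 ^ n"
    by (simp add: length_n_lists numeral_2_eq_2)
  ultimately show ?thesis
    using bij_betw_nth[OF d, of "{..<2 ^ n}" "cube n"] by simp
qed

lemma finite_cube: "finite (cube n)" and card_cube: "card (cube n) = 2 ^ n"
  using bij_betw_finite[OF cube_enumeration[of n]] bij_betw_same_card[OF cube_enumeration[of n]]
  by simp_all

text \<open>The bridge from the eigenvalue definition to the operator norm: the maximal Rayleigh
  quotient \<open>l\<close> is an eigenvalue of the Gram matrix, so \<open>sqrt l\<close> is among
  the singular values and lies below their maximum.\<close>

lemma max_singular_value_bound:
  shows "max_singular_value n f \<ge> 0"
    and "(\<Sum>x\<in>cube n. (\<Sum>y\<in>cube n. f x y * u y)\<^sup>2) \<le> (max_singular_value n f)\<^sup>2 * (\<Sum>y\<in>cube n. (u y)\<^sup>2)"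
proof -
  define N :: nat where "N = 2 ^ n"
  define e where "e i = List.n_lists n [False, True] ! i" for i
  define A where "A = comm_matrix n f"
  have bij: "bij_betw e {..<N} (cube n)"
    using cube_enumeration unfolding e_def N_def .
  have A: "A \<in> carrier_mat N N" and Aij: "\<And>i j. i < N \<Longrightarrow> j < N \<Longrightarrow> A $$ (i, j) = f (e i) (e j)"
    by (simp_all add: A_def comm_matrix_def N_def e_def)
  have "N > 0" by (simp add: N_def)
  obtain l w where l: "l \<ge> 0" and w: "\<exists>j<N. w j \<noteq> 0"
    and eig: "\<And>j. j < N \<Longrightarrow> (\<Sum>i<N. f (e i) (e j) * (\<Sum>k<N. f (e i) (e k) * w k)) = l * w j"
    and le: "\<And>u. (\<Sum>i<N. (\<Sum>k<N. f (e i) (e k) * u k)\<^sup>2) \<le> l * (\<Sum>k<N. (u k)\<^sup>2)"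
    by (rule max_rayleigh_quotient[OF \<open>N > 0\<close>, of "\<lambda>i j. f (e i) (e j)"]) blast
  define v where "v = Matrix.vec N w"
  have v: "v \<in> carrier_vec N" by (simp add: v_def)
  have "(transpose_mat A * A) *\<^sub>v v = transpose_mat A *\<^sub>v (A *\<^sub>v v)"
    using A v by (intro assoc_mult_mat_vec) auto
  also have "\<dots> = l \<cdot>\<^sub>v v"
  proof (rule eq_vecI)
    fix j assume "j < dim_vec (l \<cdot>\<^sub>v v)"
    then have j: "j < N" by (simp add: v_def)
    show "vec_index (transpose_mat A *\<^sub>v (A *\<^sub>v v)) j = vec_index (l \<cdot>\<^sub>v v) j"
      using A j eig[OF j]
      by (simp add: v_def scalar_prod_def Aij atLeast0LessThan)
  qed (use A in \<open>simp add: v_def\<close>)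
  finally have "eigenvector (transpose_mat A * A) v l"
    using A v w unfolding eigenvector_def
    by (auto simp: v_def vec_eq_iff)
  then have "eigenvalue (transpose_mat A * A) ((sqrt l)\<^sup>2)"
    using l by (auto simp: eigenvalue_def)
  then have "sqrt l \<in> singular_values A"
    using l by (simp add: singular_values_def)
  then have \<sigma>: "sqrt l \<le> max_singular_value n f"
    unfolding max_singular_value_def A_def[symmetric]
    using finite_singular_values[OF A] by simp
  then show "max_singular_value n f \<ge> 0"
    using l order_trans real_sqrt_ge_zero by blast
  have l\<sigma>: "l \<le> (max_singular_value n f)\<^sup>2"
    using l \<sigma> by (metis real_sqrt_ge_0_iff real_sqrt_pow2 power_mono)
  have "(\<Sum>x\<in>cube n. (\<Sum>y\<in>cube n. f x y * u y)\<^sup>2) = (\<Sum>i<N. (\<Sum>k<N. f (e i) (e k) * u (e k))\<^sup>2)"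
    by (simp flip: sum.reindex_bij_betw[OF bij])
  also have "\<dots> \<le> l * (\<Sum>k<N. (u (e k))\<^sup>2)"
    by (rule le)
  also have "(\<Sum>k<N. (u (e k))\<^sup>2) = (\<Sum>y\<in>cube n. (u y)\<^sup>2)"
    by (rule sum.reindex_bij_betw[OF bij])
  also have "l * (\<Sum>y\<in>cube n. (u y)\<^sup>2) \<le> (max_singular_value n f)\<^sup>2 * (\<Sum>y\<in>cube n. (u y)\<^sup>2)"
    by (intro mult_right_mono l\<sigma> sum_nonneg) simp
  finally show "(\<Sum>x\<in>cube n. (\<Sum>y\<in>cube n. f x y * u y)\<^sup>2)
    \<le> (max_singular_value n f)\<^sup>2 * (\<Sum>y\<in>cube n. (u y)\<^sup>2)" .
qed

section \<open>Heavy and light parts of an empirical distribution\<close>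

definition freq :: "'a list \<Rightarrow> 'a \<Rightarrow> real" where
  "freq xs x = real (count_list xs x) / real (length xs)"

definition heavy :: "nat \<Rightarrow> 'a list \<Rightarrow> 'a list" where
  "heavy K xs = remdups (filter (\<lambda>x. length xs \<le> K * count_list xs x) xs)"

text \<open>Kept as an integer beside the normalised \<open>light_freq\<close>, because the sketch
  messages are signed sums of these counts and must range over a finite set.\<close>

definition light_count :: "nat \<Rightarrow> 'a list \<Rightarrow> 'a \<Rightarrow> nat" where
  "light_count K xs x = (if length xs \<le> K * count_list xs x then 0 else count_list xs x)"

definition light_freq :: "nat \<Rightarrow> 'a list \<Rightarrow> 'a \<Rightarrow> real" where
  "light_freq K xs x = real (light_count K xs x) / real (length xs)"

lemma sum_list_eq_sum_count:
  fixes v :: "'a \<Rightarrow> real"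
  assumes "finite X" "set xs \<subseteq> X"
  shows "sum_list (map v xs) = (\<Sum>x\<in>X. real (count_list xs x) * v x)"
  using assms(2)
proof (induction xs)
  case (Cons a xs)
  have "(\<Sum>x\<in>X. real (count_list (a # xs) x) * v x)
      = (\<Sum>x\<in>X. real (count_list xs x) * v x + (if x = a then v x else 0))"
    by (intro sum.cong refl) (auto simp: algebra_simps)
  also have "\<dots> = (\<Sum>x\<in>X. real (count_list xs x) * v x) + v a"
    using assms(1) Cons.prems by (simp add: sum.distrib)
  finally show ?case using Cons by simp
qed simp

lemma sum_freq:
  assumes "finite X" "set xs \<subseteq> X"
  shows "(\<Sum>x\<in>X. freq xs x * v x) = sum_list (map v xs) / length xs"
  unfolding sum_list_eq_sum_count[OF assms] freq_def by (simp add: sum_divide_distrib)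

lemma freq_nonneg: "freq xs x \<ge> 0" and light_freq_nonneg: "light_freq K xs x \<ge> 0"
  by (simp_all add: freq_def light_freq_def)

lemma light_freq_le: "light_freq K xs x \<le> freq xs x"
  unfolding freq_def light_freq_def light_count_def by (intro divide_right_mono) auto

lemma freq_le_1: "freq xs x \<le> 1"
  unfolding freq_def by (cases "xs = []") (auto simp: count_le_length)

lemma sum_freq_1:
  assumes "finite X" "set xs \<subseteq> X" "xs \<noteq> []"
  shows "(\<Sum>x\<in>X. freq xs x) = 1"
  using sum_freq[OF assms(1,2), of "\<lambda>_. 1"] assms(3) by (simp add: sum_list_triv)

lemma set_heavy_subset: "set (heavy K xs) \<subseteq> set xs" and distinct_heavy: "distinct (heavy K xs)"
  by (auto simp: heavy_def)

lemma heavy_light_split: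
  fixes v :: "'a \<Rightarrow> real"
  assumes "finite X" "set xs \<subseteq> X" "xs \<noteq> []"
  shows "(\<Sum>x\<in>X. freq xs x * v x) = (\<Sum>x\<in>set (heavy K xs). freq xs x * v x) + (\<Sum>x\<in>X. light_freq K xs x * v x)"
proof -
  have sub: "set (heavy K xs) \<subseteq> X" using assms set_heavy_subset by fast
  have "light_freq K xs x = (if x \<in> set (heavy K xs) then 0 else freq xs x)" for x
    using assms(3) by (auto simp: light_freq_def light_count_def freq_def heavy_def count_list_0_iff)
  then have "(\<Sum>x\<in>X. light_freq K xs x * v x) = (\<Sum>x\<in>X - set (heavy K xs). freq xs x * v x)"
    using assms(1) by (intro sum.mono_neutral_cong_right) auto
  then show ?thesis
    using sum.subset_diff[OF sub assms(1), of "\<lambda>x. freq xs x * v x"] by simp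
qed

lemma sum_heavy_le_1:
  assumes "finite X" "set xs \<subseteq> X" "xs \<noteq> []"
  shows "(\<Sum>x\<in>set (heavy K xs). freq xs x) \<le> 1"
  using sum_mono2[OF assms(1), of "set (heavy K xs)" "freq xs"] assms sum_freq_1[OF assms]
    set_heavy_subset[of K xs] freq_nonneg by fastforce

text \<open>Every heavy point carries frequency at least 1/K, and the frequencies sum to at most
  1.\<close>

lemma length_heavy:
  assumes "xs \<noteq> []"
  shows "length (heavy K xs) \<le> K"
proof -
  have "(\<Sum>x\<in>set (heavy K xs). 1) \<le> (\<Sum>x\<in>set (heavy K xs). real K * freq xs x)"
  proof (rule sum_mono)
    fix x assume "x \<in> set (heavy K xs)"
    then have "length xs \<le> K * count_list xs x" by (simp add: heavy_def)
    then have "real (length xs) \<le> real K * real (count_list xs x)"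
      by (simp flip: of_nat_mult)
    then show "1 \<le> real K * freq xs x"
      using assms by (simp add: freq_def field_simps)
  qed
  also have "\<dots> \<le> real K"
    using sum_heavy_le_1[of "set xs" xs K] assms
    by (simp add: mult_left_le flip: sum_distrib_left)
  finally have "real (card (set (heavy K xs))) \<le> real K" by simp
  then show ?thesis by (simp add: distinct_card[OF distinct_heavy])
qed

text \<open>The square of a light frequency is at most 1/K times the frequency itself, and the
  frequencies sum to 1.\<close>

lemma sum_light_sq_le:
  assumes "finite X" "set xs \<subseteq> X" "xs \<noteq> []" "K > 0"
  shows "(\<Sum>x\<in>X. (light_freq K xs x)\<^sup>2) \<le> 1 / K"
proof -
  have "light_freq K xs x \<le> 1 / K" for x
  proof (cases "length xs \<le> K * count_list xs x")
    case False
    then have "real K * real (count_list xs x) \<le> real (length xs)"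
      by (simp flip: of_nat_mult)
    then show ?thesis
      using assms(3,4) False by (simp add: light_freq_def light_count_def field_simps)
  qed (simp add: light_freq_def light_count_def)
  then have "(\<Sum>x\<in>X. (light_freq K xs x)\<^sup>2) \<le> (\<Sum>x\<in>X. 1 / K * freq xs x)"
    unfolding power2_eq_square
    by (intro sum_mono mult_mono light_freq_le light_freq_nonneg) auto
  also have "\<dots> = 1 / K"
    using sum_freq_1[OF assms(1-3)] by (simp flip: sum_distrib_left sum_divide_distrib)
  finally show ?thesis .
qed

text \<open>Covers the regime in which \<open>K\<close> reaches the sample size: every point that
  occurs at all is then heavy.\<close>

lemma light_freq_eq_0:
  assumes "length xs \<le> K"
  shows "light_freq K xs x = 0"
proof (cases "count_list xs x = 0")
  case False
  then have "K * 1 \<le> K * count_list xs x" by (intro mult_le_mono2) simp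
  then have "length xs \<le> K * count_list xs x" using assms by linarith
  then show ?thesis by (simp add: light_freq_def light_count_def)
qed (simp add: light_freq_def light_count_def)

lemma sum_freq_sq_le:
  assumes "finite X" "set xs \<subseteq> X" "xs \<noteq> []"
  shows "(\<Sum>x\<in>X. (freq xs x)\<^sup>2) \<le> 1" "(\<Sum>x\<in>X. (light_freq K xs x)\<^sup>2) \<le> 1"
proof -
  have "(\<Sum>x\<in>X. (freq xs x)\<^sup>2) \<le> (\<Sum>x\<in>X. freq xs x)"
    by (intro sum_mono) (simp add: power2_eq_square mult_left_le freq_nonneg freq_le_1)
  then show le: "(\<Sum>x\<in>X. (freq xs x)\<^sup>2) \<le> 1" using sum_freq_1[OF assms] by simp
  have "(\<Sum>x\<in>X. (light_freq K xs x)\<^sup>2) \<le> (\<Sum>x\<in>X. (freq xs x)\<^sup>2)"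
    by (intro sum_mono power_mono light_freq_le light_freq_nonneg)
  then show "(\<Sum>x\<in>X. (light_freq K xs x)\<^sup>2) \<le> 1" using le by simp
qed

section \<open>Kernels of bounded spectral norm\<close>

text \<open>All that the protocol uses of the matrix, phrased for functions on a finite set: bounded
  entries and a bound on the operator norm.\<close>

locale kernel =
  fixes X :: "'a set" and f :: "'a \<Rightarrow> 'a \<Rightarrow> real" and \<sigma> :: real
  assumes finite_X: "finite X"
    and f_bound: "\<And>x y. x \<in> X \<Longrightarrow> y \<in> X \<Longrightarrow> \<bar>f x y\<bar> \<le> 1"
    and row_bound: "\<And>u. (\<Sum>x\<in>X. (\<Sum>y\<in>X. f x y * u y)\<^sup>2) \<le> \<sigma>\<^sup>2 * (\<Sum>y\<in>X. (u y)\<^sup>2)"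
begin

text \<open>\<open>T\<close> is the inner product of \<open>u\<close> with the matrix applied to
  \<open>t\<close>, so Cauchy-Schwarz and \<open>row_bound\<close> bound its square by a multiple of
  \<open>T\<close>, and one factor cancels. Bob's heavy points are evaluated against column
  averages, hence the need for the transpose.\<close>

lemma transpose: "kernel X (\<lambda>x y. f y x) \<sigma>"
proof
  fix u :: "'a \<Rightarrow> real"
  define t where "t y = (\<Sum>x\<in>X. f x y * u x)" for y
  define T where "T = (\<Sum>y\<in>X. (t y)\<^sup>2)"
  have T0: "T \<ge> 0" and U0: "(\<Sum>x\<in>X. (u x)\<^sup>2) \<ge> 0"
    unfolding T_def by (simp_all add: sum_nonneg)
  have "T = (\<Sum>y\<in>X. \<Sum>x\<in>X. u x * (f x y * t y))"
    by (simp add: T_def power2_eq_square sum_distrib_right t_def[of y for y] mult_ac flip: t_def)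
  also have "\<dots> = (\<Sum>x\<in>X. u x * (\<Sum>y\<in>X. f x y * t y))"
    by (subst sum.swap) (simp add: sum_distrib_left)
  finally have "T\<^sup>2 \<le> (\<Sum>x\<in>X. (u x)\<^sup>2) * (\<Sum>x\<in>X. (\<Sum>y\<in>X. f x y * t y)\<^sup>2)"
    using Cauchy_Schwarz_ineq_sum[of u "\<lambda>x. \<Sum>y\<in>X. f x y * t y" X] by simp
  also have "\<dots> \<le> (\<Sum>x\<in>X. (u x)\<^sup>2) * (\<sigma>\<^sup>2 * T)"
    unfolding T_def by (intro mult_left_mono row_bound U0)
  finally have "T * T \<le> (\<sigma>\<^sup>2 * (\<Sum>x\<in>X. (u x)\<^sup>2)) * T"
    by (simp add: power2_eq_square mult_ac)
  then have "T \<le> \<sigma>\<^sup>2 * (\<Sum>x\<in>X. (u x)\<^sup>2)"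
    using T0 U0 by (cases "T = 0") (auto simp: mult_le_cancel_right)
  then show "(\<Sum>x\<in>X. (\<Sum>y\<in>X. f y x * u y)\<^sup>2) \<le> \<sigma>\<^sup>2 * (\<Sum>y\<in>X. (u y)\<^sup>2)"
    by (simp add: T_def t_def)
qed (use finite_X f_bound in auto)

text \<open>Chebyshev counting: the image of \<open>u\<close> has squared norm at most
  \<open>\<sigma>\<^sup>2\<close>. This is what makes the hash range independent of the
  dimension.\<close>

lemma large_entries_card:
  assumes e: "e > 0" and u: "(\<Sum>y\<in>X. (u y)\<^sup>2) \<le> 1"
  shows "real (card {x\<in>X. \<bar>\<Sum>y\<in>X. f x y * u y\<bar> > e}) * e\<^sup>2 \<le> \<sigma>\<^sup>2"
proof -
  let ?T = "{x\<in>X. \<bar>\<Sum>y\<in>X. f x y * u y\<bar> > e}"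
  have "real (card ?T) * e\<^sup>2 = (\<Sum>x\<in>?T. e\<^sup>2)" by simp
  also have "\<dots> \<le> (\<Sum>x\<in>?T. (\<Sum>y\<in>X. f x y * u y)\<^sup>2)"
    using e by (intro sum_mono) (auto simp: abs_le_square_iff[symmetric])
  also have "\<dots> \<le> (\<Sum>x\<in>X. (\<Sum>y\<in>X. f x y * u y)\<^sup>2)"
    using finite_X by (intro sum_mono2) auto
  also have "\<dots> \<le> \<sigma>\<^sup>2 * 1"
    using row_bound[of u] u by (meson mult_left_mono order_trans zero_le_power2)
  finally show ?thesis by simp
qed

lemma weighted_average_le_1:
  assumes "\<And>y. y \<in> X \<Longrightarrow> u y \<ge> 0" "(\<Sum>y\<in>X. u y) \<le> 1" "x \<in> X"
  shows "\<bar>\<Sum>y\<in>X. f x y * u y\<bar> \<le> 1"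
proof -
  have "\<bar>\<Sum>y\<in>X. f x y * u y\<bar> \<le> (\<Sum>y\<in>X. 1 * u y)"
    using assms f_bound
    by (intro order_trans[OF sum_abs] sum_mono) (auto simp: abs_mult intro!: mult_left_le_one_le)
  then show ?thesis using assms by simp
qed

end

section \<open>The protocol\<close>

text \<open>The added 1 acts as a padding symbol that brings all lists to length \<open>K\<close>,
  so a heavy list costs a fixed number of bits per slot.\<close>

lemma card_lists_length_le_bound:
  assumes "finite A"
  shows "card {xs. set xs \<subseteq> A \<and> length xs \<le> K} \<le> (card A + 1) ^ K"
proof -
  have "(\<Sum>i\<le>K. card A ^ i) \<le> (card A + 1) ^ K"
  proof (induction K)
    case (Suc K)
    have "card A ^ Suc K \<le> card A * (card A + 1) ^ K"
      unfolding power_Suc by (intro mult_le_mono2 power_mono) simp_all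
    with Suc have "(\<Sum>i\<le>Suc K. card A ^ i) \<le> (card A + 1) ^ K + card A * (card A + 1) ^ K"
      unfolding sum.atMost_Suc by (rule add_mono)
    then show ?case by simp
  qed simp
  then show ?thesis by (simp add: card_lists_length_le[OF assms])
qed

text \<open>\<open>m\<close> samples per party, heaviness threshold \<open>1/K\<close>, \<open>M\<close> hash values, \<open>k\<close> sign sketches;
  \<open>b\<close> bits suffice for one symbol of any message, and each of the nine sources of error
  contributes at most \<open>e\<close>.\<close>

locale estimator = kernel X f \<sigma> for X :: "'a set" and f and \<sigma> :: real +
  fixes e :: real and m K M k b :: nat
  assumes e: "0 < e" "e \<le> 1 / 4"
    and pos: "m > 0" "K > 0" "M > 0" "k > 0"
    and enough_samples: "15 \<le> m * e\<^sup>2"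
    and enough_hashes: "15 * K * \<sigma>\<^sup>2 \<le> M * e\<^sup>2"
    and enough_signs: "m \<le> K \<or> 30 * \<sigma>\<^sup>2 \<le> k * (real K)\<^sup>2 * e\<^sup>2"
    and enough_bits: "M * (m + 1) + 1 \<le> 2 ^ b" "2 * m + 1 \<le> 2 ^ b" "4 / e + 2 \<le> 2 ^ b"
begin

definition row_avg :: "('a \<Rightarrow> real) \<Rightarrow> 'a \<Rightarrow> real" where
  "row_avg u x = (\<Sum>y\<in>X. f x y * u y)"

definition col_avg :: "('a \<Rightarrow> real) \<Rightarrow> 'a \<Rightarrow> real" where
  "col_avg u y = (\<Sum>x\<in>X. f x y * u x)"

definition big :: "('a \<Rightarrow> real) \<Rightarrow> 'a set" where
  "big v = {x\<in>X. \<bar>v x\<bar> > e}"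

definition heavy_msg :: "('a \<Rightarrow> nat) \<Rightarrow> 'a list \<Rightarrow> (nat \<times> nat) list" where
  "heavy_msg h xs = hashed h (count_list xs) (heavy K xs)"

definition decode :: "('a \<Rightarrow> nat) \<Rightarrow> ('a \<Rightarrow> real) \<Rightarrow> (nat \<times> nat) list \<Rightarrow> real" where
  "decode h v l = unhash_sum h (big v) v l / m"

text \<open>The cut-off at 2 only serves to keep the set of messages finite: the rounded quantities are
  within it whenever the randomness is good.\<close>

definition rnd :: "real \<Rightarrow> int" where
  "rnd t = (if \<bar>t\<bar> \<le> 2 then \<lfloor>t / e\<rfloor> else 0)"

definition sketch_msg :: "('a \<Rightarrow> real) list \<Rightarrow> 'a list \<Rightarrow> real list" where
  "sketch_msg gs xs = map (\<lambda>g. \<Sum>x\<in>X. real (light_count K xs x) * g x) gs"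

text \<open>Bob applies the matrix to his light part before sketching it. The signs are therefore
  indexed by rows, and the bilinear form becomes an ordinary inner product.\<close>

definition light_decode :: "('a \<Rightarrow> real) list \<Rightarrow> 'a list \<Rightarrow> real list \<Rightarrow> real" where
  "light_decode gs ys l =
     (\<Sum>(g, c)\<leftarrow>zip gs l. c / m * (\<Sum>x\<in>X. row_avg (light_freq K ys) x * g x)) / k"

definition bob_total ::
  "('a \<Rightarrow> nat) \<Rightarrow> ('a \<Rightarrow> real) list \<Rightarrow> 'a list \<Rightarrow> (nat \<times> nat) list \<Rightarrow> real list \<Rightarrow> int \<Rightarrow> real" where
  "bob_total h gs ys l1 l2 z = decode h (row_avg (freq ys)) l1 + light_decode gs ys l2 + e * of_int z"

text \<open>Alice's inner \<open>rnd\<close> value can be formed only after Bob's heavy list has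
  arrived; Bob adds it to the two parts that he decodes himself. The outer rounding is there because
  the output must be announced to both parties.\<close>

definition outcome :: "('a \<Rightarrow> nat) \<Rightarrow> ('a \<Rightarrow> real) list \<Rightarrow> 'a list \<Rightarrow> 'a list \<Rightarrow> real" where
  "outcome h gs xs ys = e * of_int (rnd (bob_total h gs ys (heavy_msg h xs) (sketch_msg gs xs)
     (rnd (decode h (col_avg (light_freq K xs)) (heavy_msg h ys)))))"

text \<open>One summand per message, in order of play: Bob's heavy list, Alice's heavy list, the
  sketches, Alice's rounded value, the rounded output. The nesting and the 0 of the leaf follow the
  protocol tree.\<close>

definition cost :: nat where
  "cost = b * K + (b * K + (b * k + (b + (b + 0))))"

section \<open>Message alphabets and the protocol tree\<close>

lemma heavy_messages:
  defines "S \<equiv> {l. set l \<subseteq> {..<M} \<times> {..m} \<and> length l \<le> K}"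
  shows "finite S" "card S \<le> 2 ^ (b * K)"
    and "h \<in> X \<rightarrow>\<^sub>E {..<M} \<Longrightarrow> set xs \<subseteq> X \<Longrightarrow> length xs = m \<Longrightarrow> heavy_msg h xs \<in> S"
proof -
  show "finite S" unfolding S_def by (intro finite_lists_length_le) simp
  have "card S \<le> (card ({..<M} \<times> {..m}) + 1) ^ K"
    unfolding S_def by (intro card_lists_length_le_bound) simp
  also have "\<dots> \<le> (2 ^ b) ^ K"
    using enough_bits(1) by (intro power_mono) (simp_all add: card_cartesian_product)
  finally show "card S \<le> 2 ^ (b * K)" by (simp add: power_mult)
  assume h: "h \<in> X \<rightarrow>\<^sub>E {..<M}" and xs: "set xs \<subseteq> X" "length xs = m"
  have "xs \<noteq> []" using xs pos by auto
  then show "heavy_msg h xs \<in> S"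
    using h xs set_heavy_subset[of K xs] length_heavy[of xs K]
    by (auto simp: S_def heavy_msg_def hashed_def count_le_length)
qed

text \<open>The light counts add up to at most \<open>m\<close>, so each signed sum is one of the
  \<open>2 * m + 1\<close> integers between \<open>- m\<close> and \<open>m\<close>.\<close>

lemma sketch_messages:
  defines "S \<equiv> {l. set l \<subseteq> real_of_int ` {- int m..int m} \<and> length l = k}"
  shows "finite S" "card S \<le> 2 ^ (b * k)"
    and "set gs \<subseteq> X \<rightarrow>\<^sub>E {-1, 1} \<Longrightarrow> length gs = k \<Longrightarrow> set xs \<subseteq> X \<Longrightarrow> length xs = m \<Longrightarrow>
      sketch_msg gs xs \<in> S"
proof -
  show "finite S" unfolding S_def by (intro finite_lists_length_eq) simp
  have "card (real_of_int ` {- int m..int m}) = 2 * m + 1"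
    by (subst card_image) (auto simp: inj_on_def)
  then have "card S = (2 * m + 1) ^ k"
    unfolding S_def by (subst card_lists_length_eq) auto
  also have "\<dots> \<le> (2 ^ b) ^ k"
    using enough_bits(2) by (intro power_mono) simp_all
  finally show "card S \<le> 2 ^ (b * k)" by (simp add: power_mult)
  assume gs: "set gs \<subseteq> X \<rightarrow>\<^sub>E {-1, 1}" "length gs = k" and xs: "set xs \<subseteq> X" "length xs = m"
  have ne: "xs \<noteq> []" using xs pos by auto
  have "(\<Sum>x\<in>X. light_freq K xs x) \<le> (\<Sum>x\<in>X. freq xs x)"
    by (intro sum_mono light_freq_le)
  then have "(\<Sum>x\<in>X. light_freq K xs x) \<le> 1"
    using sum_freq_1[OF finite_X xs(1) ne] by simp
  then have lc: "(\<Sum>x\<in>X. real (light_count K xs x)) \<le> m"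
    using pos xs by (simp add: light_freq_def flip: sum_divide_distrib)
  have "(\<Sum>x\<in>X. real (light_count K xs x) * g x) \<in> real_of_int ` {- int m..int m}"
    if g: "g \<in> X \<rightarrow>\<^sub>E {-1, 1}" for g
  proof -
    define G :: "'a \<Rightarrow> int" where "G x = (if g x = 1 then 1 else -1)" for x
    have gG: "g x = real_of_int (G x)" "\<bar>g x\<bar> = 1" if "x \<in> X" for x
      using g that by (auto simp: G_def PiE_iff)
    have "\<bar>\<Sum>x\<in>X. real (light_count K xs x) * g x\<bar> \<le> (\<Sum>x\<in>X. real (light_count K xs x))"
      by (intro order_trans[OF sum_abs] sum_mono) (simp add: gG(2) abs_mult)
    moreover have eq: "(\<Sum>x\<in>X. real (light_count K xs x) * g x)
        = real_of_int (\<Sum>x\<in>X. int (light_count K xs x) * G x)"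
      by (simp add: gG(1))
    ultimately have "real_of_int \<bar>\<Sum>x\<in>X. int (light_count K xs x) * G x\<bar> \<le> real_of_int (int m)"
      using lc by (simp only: of_int_abs of_int_of_nat_eq)
    then have "\<bar>\<Sum>x\<in>X. int (light_count K xs x) * G x\<bar> \<le> int m"
      by (simp only: of_int_le_iff)
    then show ?thesis
      unfolding eq by (intro imageI) auto
  qed
  then show "sketch_msg gs xs \<in> S"
    using gs by (auto simp: S_def sketch_msg_def)
qed

lemma rnd_messages:
  defines "S \<equiv> {\<lfloor>- 2 / e\<rfloor>..\<lfloor>2 / e\<rfloor>}"
  shows "finite S" "card S \<le> 2 ^ b" "rnd t \<in> S"
proof -
  show "finite S" by (simp add: S_def)
  have "real (card S) \<le> 4 / e + 2"
  proof -
    have "- 2 / e \<le> 2 / e" using e by (intro divide_right_mono) auto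
    then have "\<lfloor>- 2 / e\<rfloor> \<le> \<lfloor>2 / e\<rfloor>" by (rule floor_mono)
    then have "real (card S) = real_of_int (\<lfloor>2 / e\<rfloor> + 1 - \<lfloor>- 2 / e\<rfloor>)"
      by (simp add: S_def)
    also have "\<dots> \<le> 2 / e + 1 - (- 2 / e - 1)"
      by linarith
    finally show ?thesis by simp
  qed
  also have "\<dots> \<le> real (2 ^ b)" using enough_bits(3) by simp
  finally show "card S \<le> 2 ^ b" by (simp only: of_nat_le_iff)
  show "rnd t \<in> S"
  proof (cases "\<bar>t\<bar> \<le> 2")
    case True
    then have "- 2 / e \<le> t / e" "t / e \<le> 2 / e"
      using e by (intro divide_right_mono; simp add: abs_le_iff)+
    then show ?thesis using True by (auto simp: S_def rnd_def intro: floor_mono)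
  next
    case False
    have "0 < 2 / e" using e by simp
    then have "- 1 < 2 / e" by linarith
    then show ?thesis using False e by (simp add: S_def rnd_def)
  qed
qed

lemma rnd_error: "\<bar>t\<bar> \<le> 2 \<Longrightarrow> \<bar>e * of_int (rnd t) - t\<bar> \<le> e"
proof -
  assume "\<bar>t\<bar> \<le> 2"
  then have "rnd t = \<lfloor>t / e\<rfloor>" by (simp add: rnd_def)
  then have "real_of_int (rnd t) \<le> t / e" "t / e - 1 \<le> real_of_int (rnd t)" by linarith+
  then have "e * of_int (rnd t) \<le> t" "t - e \<le> e * of_int (rnd t)"
    using e by (simp_all add: field_simps)
  then show ?thesis using e by simp
qed

text \<open>The expression \<open>outcome\<close> is evaluated from the inside out, one message per
  round; each \<open>F\<close> is what remains once that message has become a constant. The samples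
  are functions of the inputs, which here stand for whole distributions.\<close>

lemma outcome_protocol:
  fixes xs :: "'p \<Rightarrow> 'a list" and ys :: "'q \<Rightarrow> 'a list"
  assumes h: "h \<in> X \<rightarrow>\<^sub>E {..<M}" and gs: "set gs \<subseteq> X \<rightarrow>\<^sub>E {-1, 1}" "length gs = k"
    and xs: "\<And>p. set (xs p) \<subseteq> X" "\<And>p. length (xs p) = m"
    and ys: "\<And>q. set (ys q) \<subseteq> X" "\<And>q. length (ys q) = m"
  shows "\<exists>\<pi>. depth \<pi> \<le> cost \<and> (\<forall>p q. run \<pi> p q = outcome h gs (xs p) (ys q))"
  unfolding outcome_def cost_def
proof (rule bob_sends[OF heavy_messages(1,2), where msg="\<lambda>q. heavy_msg h (ys q)"
    and F="\<lambda>l p q. e * of_int (rnd (bob_total h gs (ys q) (heavy_msg h (xs p)) (sketch_msg gs (xs p))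
     (rnd (decode h (col_avg (light_freq K (xs p))) l))))"],
    rule heavy_messages(3)[OF h ys])
  fix l
  show "\<exists>\<pi>. depth \<pi> \<le> b * K + (b * k + (b + (b + 0))) \<and>
    (\<forall>p q. run \<pi> p q = e * of_int (rnd (bob_total h gs (ys q) (heavy_msg h (xs p)) (sketch_msg gs (xs p))
     (rnd (decode h (col_avg (light_freq K (xs p))) l)))))"
  proof (rule alice_sends[OF heavy_messages(1,2), where msg="\<lambda>p. heavy_msg h (xs p)"
      and F="\<lambda>l1 p q. e * of_int (rnd (bob_total h gs (ys q) l1 (sketch_msg gs (xs p))
       (rnd (decode h (col_avg (light_freq K (xs p))) l))))"],
      rule heavy_messages(3)[OF h xs])
    fix l1
    show "\<exists>\<pi>. depth \<pi> \<le> b * k + (b + (b + 0)) \<and>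
      (\<forall>p q. run \<pi> p q = e * of_int (rnd (bob_total h gs (ys q) l1 (sketch_msg gs (xs p))
       (rnd (decode h (col_avg (light_freq K (xs p))) l)))))"
    proof (rule alice_sends[OF sketch_messages(1,2), where msg="\<lambda>p. sketch_msg gs (xs p)"
        and F="\<lambda>l2 p q. e * of_int (rnd (bob_total h gs (ys q) l1 l2
         (rnd (decode h (col_avg (light_freq K (xs p))) l))))"],
        rule sketch_messages(3)[OF gs xs])
      fix l2
      show "\<exists>\<pi>. depth \<pi> \<le> b + (b + 0) \<and>
        (\<forall>p q. run \<pi> p q = e * of_int (rnd (bob_total h gs (ys q) l1 l2
         (rnd (decode h (col_avg (light_freq K (xs p))) l)))))"
      proof (rule alice_sends[OF rnd_messages(1,2),
          where msg="\<lambda>p. rnd (decode h (col_avg (light_freq K (xs p))) l)"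
          and F="\<lambda>z p q. e * of_int (rnd (bob_total h gs (ys q) l1 l2 z))"], rule rnd_messages(3))
        fix z
        show "\<exists>\<pi>. depth \<pi> \<le> b + 0 \<and>
          (\<forall>(p::'p) q. run \<pi> p q = e * of_int (rnd (bob_total h gs (ys q) l1 l2 z)))"
        proof (rule bob_sends[OF rnd_messages(1,2),
            where msg="\<lambda>q. rnd (bob_total h gs (ys q) l1 l2 z)"
            and F="\<lambda>z' p q. e * of_int z'"], rule rnd_messages(3))
          fix z' :: int
          show "\<exists>\<pi>. depth \<pi> \<le> 0 \<and> (\<forall>(p::'p) (q::'q). run \<pi> p q = e * of_int z')"
            by (intro exI[of _ "Output (e * of_int z')"]) simp
        qed
      qed
    qed
  qed
qed

section \<open>Accuracy of the outcome for good randomness\<close>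

definition bilin :: "('a \<Rightarrow> real) \<Rightarrow> ('a \<Rightarrow> real) \<Rightarrow> real" where
  "bilin u w = (\<Sum>x\<in>X. u x * row_avg w x)"

lemma bilin_col: "bilin u w = (\<Sum>y\<in>X. w y * col_avg u y)"
  unfolding bilin_def row_avg_def col_avg_def sum_distrib_left
  by (subst sum.swap) (simp add: mult_ac)

text \<open>Division by \<open>m\<close> turns counts into frequencies, whose sum over the heavy
  points is at most 1, so the error is \<open>e\<close> in total and not \<open>e\<close> per
  point.\<close>

lemma decode_error:
  assumes xs: "set xs \<subseteq> X" "length xs = m"
    and sep: "\<not> (\<exists>x\<in>set (heavy K xs). \<exists>y\<in>big v. x \<noteq> y \<and> h x = h y)"
  shows "\<bar>decode h v (heavy_msg h xs) - (\<Sum>x\<in>set (heavy K xs). freq xs x * v x)\<bar> \<le> e"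
proof -
  have ne: "xs \<noteq> []" using xs pos by auto
  have sub: "set (heavy K xs) \<subseteq> X" using xs set_heavy_subset by fast
  let ?c = "\<lambda>x. real (count_list xs x)"
  have "\<bar>unhash_sum h (big v) v (heavy_msg h xs) - (\<Sum>x\<in>set (heavy K xs). ?c x * v x)\<bar>
      \<le> e * (\<Sum>x\<in>set (heavy K xs). ?c x)"
    using unhash_sum_hashed[OF finite_X sub distinct_heavy big_def _ sep, of "count_list xs"] e
    by (simp add: heavy_msg_def)
  then have "\<bar>(unhash_sum h (big v) v (heavy_msg h xs) - (\<Sum>x\<in>set (heavy K xs). ?c x * v x)) / m\<bar>
      \<le> e * (\<Sum>x\<in>set (heavy K xs). ?c x) / m"
    using pos by (simp add: divide_right_mono)
  also have "\<dots> = e * (\<Sum>x\<in>set (heavy K xs). freq xs x)"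
    using xs by (simp add: freq_def flip: sum_divide_distrib)
  also have "\<dots> \<le> e"
    using sum_heavy_le_1[OF finite_X xs(1) ne] e by (simp add: mult_left_le)
  finally show ?thesis
    using xs by (simp add: decode_def freq_def diff_divide_distrib sum_divide_distrib)
qed

lemma outcome_error:
  assumes xs: "set xs \<subseteq> X" "length xs = m" and ys: "set ys \<subseteq> X" "length ys = m"
    and sepA: "\<not> (\<exists>x\<in>set (heavy K xs). \<exists>y\<in>big (row_avg (freq ys)). x \<noteq> y \<and> h x = h y)"
    and sepB: "\<not> (\<exists>x\<in>set (heavy K ys). \<exists>y\<in>big (col_avg (light_freq K xs)). x \<noteq> y \<and> h x = h y)"
    and sk: "\<bar>(\<Sum>g\<leftarrow>gs. (\<Sum>x\<in>X. light_freq K xs x * g x) * (\<Sum>x\<in>X. row_avg (light_freq K ys) x * g x)) / k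
      - bilin (light_freq K xs) (light_freq K ys)\<bar> \<le> e"
  shows "\<bar>outcome h gs xs ys - bilin (freq xs) (freq ys)\<bar> \<le> 5 * e"
proof -
  interpret t: kernel X "\<lambda>x y. f y x" \<sigma> by (rule transpose)
  have ne: "xs \<noteq> []" "ys \<noteq> []" using xs ys pos by auto
  define P1 where "P1 = (\<Sum>x\<in>set (heavy K xs). freq xs x * row_avg (freq ys) x)"
  define P2 where "P2 = (\<Sum>y\<in>set (heavy K ys). freq ys y * col_avg (light_freq K xs) y)"
  define P3 where "P3 = bilin (light_freq K xs) (light_freq K ys)"
  have "bilin (freq xs) (freq ys) = P1 + bilin (light_freq K xs) (freq ys)"
    unfolding bilin_def P1_def by (rule heavy_light_split[OF finite_X xs(1) ne(1)])
  also have "bilin (light_freq K xs) (freq ys) = P2 + P3"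
    unfolding P2_def P3_def bilin_col by (rule heavy_light_split[OF finite_X ys(1) ne(2)])
  finally have total: "bilin (freq xs) (freq ys) = P1 + (P2 + P3)" .
  have lsum: "(\<Sum>x\<in>X. light_freq K xs x) \<le> 1"
    using sum_mono[of X "light_freq K xs" "freq xs"] light_freq_le sum_freq_1[OF finite_X xs(1) ne(1)]
    by fastforce
  have col1: "\<bar>col_avg (light_freq K xs) y\<bar> \<le> 1" if "y \<in> X" for y
    unfolding col_avg_def by (intro t.weighted_average_le_1 light_freq_nonneg lsum that)
  have row1: "\<bar>row_avg (freq ys) x\<bar> \<le> 1" if "x \<in> X" for x
    unfolding row_avg_def
    by (intro weighted_average_le_1 freq_nonneg that) (simp add: sum_freq_1[OF finite_X ys(1) ne(2)])
  have avg: "\<bar>\<Sum>x\<in>A. u x * v x\<bar> \<le> 1"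
    if "A \<subseteq> X" "\<And>x. u x \<ge> 0" "sum u A \<le> 1" "\<And>x. x \<in> X \<Longrightarrow> \<bar>v x\<bar> \<le> 1" for A and u v :: "'a \<Rightarrow> real"
  proof -
    have "\<bar>\<Sum>x\<in>A. u x * v x\<bar> \<le> (\<Sum>x\<in>A. u x)"
      using that by (intro order_trans[OF sum_abs] sum_mono) (auto simp: abs_mult mult_left_le)
    then show ?thesis using that by simp
  qed
  have P2_1: "\<bar>P2\<bar> \<le> 1"
    unfolding P2_def using ys set_heavy_subset[of K ys]
    by (intro avg freq_nonneg sum_heavy_le_1[OF finite_X ys(1) ne(2)] col1) auto
  have all_1: "\<bar>bilin (freq xs) (freq ys)\<bar> \<le> 1"
    unfolding bilin_def
    by (intro avg freq_nonneg row1) (simp_all add: sum_freq_1[OF finite_X xs(1) ne(1)])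
  define sA where "sA = decode h (col_avg (light_freq K xs)) (heavy_msg h ys)"
  have eA: "\<bar>sA - P2\<bar> \<le> e"
    unfolding sA_def P2_def by (rule decode_error[OF ys sepB])
  then have "\<bar>sA\<bar> \<le> 2" using P2_1 e by linarith
  then have rA: "\<bar>e * of_int (rnd sA) - sA\<bar> \<le> e" by (rule rnd_error)
  have eB: "\<bar>decode h (row_avg (freq ys)) (heavy_msg h xs) - P1\<bar> \<le> e"
    unfolding P1_def by (rule decode_error[OF xs sepA])
  have "light_decode gs ys (sketch_msg gs xs)
      = (\<Sum>g\<leftarrow>gs. (\<Sum>x\<in>X. light_freq K xs x * g x) * (\<Sum>x\<in>X. row_avg (light_freq K ys) x * g x)) / k"
    using xs by (simp add: light_decode_def sketch_msg_def zip_map2 zip_same_conv_map comp_def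
        light_freq_def[of K xs] flip: sum_divide_distrib)
  then have eS: "\<bar>light_decode gs ys (sketch_msg gs xs) - P3\<bar> \<le> e"
    using sk by (simp add: P3_def)
  define sB where "sB = bob_total h gs ys (heavy_msg h xs) (sketch_msg gs xs) (rnd sA)"
  have tB: "\<bar>sB - bilin (freq xs) (freq ys)\<bar> \<le> 4 * e"
    unfolding sB_def bob_total_def total using eA rA eB eS by linarith
  \<comment> \<open>The true value is at most 1 and the error at most \<open>4 * e\<close>; the
    assumption that \<open>e\<close> is at most 1/4 keeps \<open>sB\<close> within the cut-off of
    \<open>rnd\<close>.\<close>
  then have "\<bar>sB\<bar> \<le> 2" using all_1 e by linarith
  then have "\<bar>e * of_int (rnd sB) - sB\<bar> \<le> e" by (rule rnd_error)
  moreover have "outcome h gs xs ys = e * of_int (rnd sB)"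
    by (simp add: outcome_def sB_def sA_def)
  ultimately show ?thesis using tB by linarith
qed

end

section \<open>Probability of failure\<close>

context estimator
begin

text \<open>Values between -1 and 1 have variance at most 1, so Chebyshev leaves
  \<open>1 / (m * e\<^sup>2)\<close>.\<close>

lemma sample_prob:
  fixes N :: nat
  assumes N: "N > 0" and v: "\<And>x. x \<in> X \<Longrightarrow> \<bar>v x\<bar> \<le> 1" and \<phi>: "\<And>r. \<phi> r \<in> X"
  shows "measure_pmf.prob (replicate_pmf m (pmf_of_set {..<N}))
    {r. \<bar>sum_list (map v (map \<phi> r)) / m - (\<Sum>i<N. v (\<phi> i)) / N\<bar> > e} \<le> 1 / 15"
proof -
  let ?D = "pmf_of_set {..<N}"
  have D: "finite {..<N}" "{..<N} \<noteq> {}" using N by auto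
  define Y where "Y i = v (\<phi> i)" for i
  define \<mu> where "\<mu> = measure_pmf.expectation ?D Y"
  have \<mu>: "\<mu> = (\<Sum>i<N. v (\<phi> i)) / N"
    using D by (simp add: \<mu>_def Y_def integral_pmf_of_set)
  note int = integrable_measure_pmf_finite[of ?D] set_pmf_of_set[OF D(2,1)]
  have "measure_pmf.expectation ?D (\<lambda>i. (Y i - \<mu>)\<^sup>2)
      = measure_pmf.expectation ?D (\<lambda>i. (Y i)\<^sup>2) - \<mu>\<^sup>2"
    using measure_pmf.variance_eq[of ?D Y] by (simp add: int \<mu>_def)
  also have "\<dots> \<le> measure_pmf.expectation ?D (\<lambda>i. (Y i)\<^sup>2)" by simp
  also have "\<dots> \<le> measure_pmf.expectation ?D (\<lambda>i. 1)"
    using v \<phi> by (intro integral_mono) (auto simp: int Y_def abs_square_le_1)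
  finally have V: "measure_pmf.expectation ?D (\<lambda>i. (Y i - \<mu>)\<^sup>2) \<le> 1" by simp
  have "measure_pmf.prob (replicate_pmf m ?D) {r. \<bar>sum_list (map Y r) / m - \<mu>\<bar> > e} \<le> 1 / (m * e\<^sup>2)"
    unfolding \<mu>_def using V[unfolded \<mu>_def] pos(1) e(1)
    by (intro sample_mean_deviation) (auto simp: int)
  also have "\<dots> \<le> 1 / 15"
    using enough_samples by (intro divide_left_mono) auto
  finally show ?thesis
    by (simp add: \<mu> Y_def[abs_def] comp_def)
qed

lemma separation_prob:
  assumes xs: "set xs \<subseteq> X" "length xs = m" and v: "real (card (big v)) * e\<^sup>2 \<le> \<sigma>\<^sup>2"
  shows "measure_pmf.prob (pmf_of_set (X \<rightarrow>\<^sub>E {..<M}))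
    {h. \<exists>x\<in>set (heavy K xs). \<exists>y\<in>big v. x \<noteq> y \<and> h x = h y} \<le> 1 / 15"
proof -
  have "xs \<noteq> []" using xs pos by auto
  then have H: "card (set (heavy K xs)) \<le> K"
    using length_heavy[of xs K] card_length[of "heavy K xs"] by linarith
  have "measure_pmf.prob (pmf_of_set (X \<rightarrow>\<^sub>E {..<M}))
      {h. \<exists>x\<in>set (heavy K xs). \<exists>y\<in>big v. x \<noteq> y \<and> h x = h y}
    \<le> real (card (set (heavy K xs))) * real (card (big v)) / real M"
    using xs set_heavy_subset[of K xs] pos
    by (intro hash_separates_prob finite_X) (auto simp: big_def)
  also have "\<dots> \<le> real K * real (card (big v)) / real M"
    using H by (intro divide_right_mono mult_right_mono) auto
  also have "\<dots> \<le> 1 / 15"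
  proof -
    have "15 * real K * (real (card (big v)) * e\<^sup>2) \<le> 15 * real K * \<sigma>\<^sup>2"
      using v by (intro mult_left_mono) auto
    also have "\<dots> \<le> M * e\<^sup>2" using enough_hashes by simp
    finally have "(15 * real K * real (card (big v))) * e\<^sup>2 \<le> M * e\<^sup>2"
      by (simp add: mult_ac)
    then have "15 * real K * real (card (big v)) \<le> M"
      using e by (simp add: mult_le_cancel_right)
    then show ?thesis using pos by (simp add: field_simps)
  qed
  finally show ?thesis .
qed

text \<open>The squared norms are at most 1/K and \<open>\<sigma>\<^sup>2 / K\<close>, and the 30 in
  \<open>enough_signs\<close> is the 2 of the sketch variance times 15. If \<open>m\<close> is at
  most \<open>K\<close>, the light part is zero and so is the variance bound.\<close>

lemma sketch_prob:
  assumes xs: "set xs \<subseteq> X" "length xs = m" and ys: "set ys \<subseteq> X" "length ys = m"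
  shows "measure_pmf.prob (replicate_pmf k (pmf_of_set (X \<rightarrow>\<^sub>E {-1, 1})))
    {gs. \<bar>(\<Sum>g\<leftarrow>gs. (\<Sum>x\<in>X. light_freq K xs x * g x) * (\<Sum>x\<in>X. row_avg (light_freq K ys) x * g x)) / k
      - bilin (light_freq K xs) (light_freq K ys)\<bar> > e} \<le> 1 / 15"
proof -
  let ?D = "pmf_of_set (X \<rightarrow>\<^sub>E {-1, 1::real})"
  have ne: "xs \<noteq> []" "ys \<noteq> []" using xs ys pos by auto
  have fin: "finite (X \<rightarrow>\<^sub>E {-1, 1::real})" and nonempty: "X \<rightarrow>\<^sub>E {-1, 1::real} \<noteq> {}"
    using finite_X by (auto intro: finite_PiE simp: PiE_eq_empty_iff)
  define U where "U = (\<Sum>x\<in>X. (light_freq K xs x)\<^sup>2)"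
  define W where "W = (\<Sum>x\<in>X. (row_avg (light_freq K ys) x)\<^sup>2)"
  have U0: "U \<ge> 0" and W0: "W \<ge> 0" by (simp_all add: U_def W_def sum_nonneg)
  note mom = sign_sketch_moments[OF finite_X, of "light_freq K xs" "row_avg (light_freq K ys)",
      folded U_def W_def bilin_def]
  have "measure_pmf.prob (replicate_pmf k ?D)
    {gs. \<bar>(\<Sum>g\<leftarrow>gs. (\<Sum>x\<in>X. light_freq K xs x * g x) * (\<Sum>x\<in>X. row_avg (light_freq K ys) x * g x)) / k
      - bilin (light_freq K xs) (light_freq K ys)\<bar> > e} \<le> (2 * U * W) / (k * e\<^sup>2)"
    unfolding mom(1)[symmetric]
    by (rule sample_mean_deviation)
       (use mom(2) pos e fin nonempty in \<open>simp_all add: set_pmf_of_set mom(1)\<close>)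
  also have "\<dots> \<le> 1 / 15"
    using enough_signs
  proof
    assume "m \<le> K"
    then have "U = 0" using xs by (simp add: U_def light_freq_eq_0)
    then show ?thesis by simp
  next
    assume s: "30 * \<sigma>\<^sup>2 \<le> k * (real K)\<^sup>2 * e\<^sup>2"
    have U: "U \<le> 1 / K"
      unfolding U_def by (rule sum_light_sq_le[OF finite_X xs(1) ne(1) pos(2)])
    have "W \<le> \<sigma>\<^sup>2 * (\<Sum>x\<in>X. (light_freq K ys x)\<^sup>2)"
      unfolding W_def row_avg_def by (rule row_bound)
    also have "\<dots> \<le> \<sigma>\<^sup>2 * (1 / K)"
      by (intro mult_left_mono sum_light_sq_le[OF finite_X ys(1) ne(2) pos(2)]) simp
    finally have "U * W \<le> 1 / K * (\<sigma>\<^sup>2 * (1 / K))"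
      using U U0 W0 by (intro mult_mono) auto
    then have "15 * (2 * U * W) \<le> 30 * \<sigma>\<^sup>2 / (real K)\<^sup>2"
      by (simp add: power2_eq_square)
    also have "\<dots> \<le> k * e\<^sup>2"
      using s pos by (simp add: field_simps)
    finally show ?thesis
      using pos e by (simp add: field_simps)
  qed
  finally show ?thesis .
qed

text \<open>Sampling is compared with the truth in two stages: Alice's sample against averages over
  Bob's full grid, then Bob's sample against column averages over Alice's sample, which is fixed by
  then.\<close>

lemma outcome_prob:
  fixes p q :: "'a pmf" and \<phi> \<psi> :: "nat \<Rightarrow> 'a" and N :: nat
  assumes N: "N > 0" "2 * real (card X) / N \<le> e"
    and p: "set_pmf p \<subseteq> X" and q: "set_pmf q \<subseteq> X"
    and \<phi>: "\<And>r. \<phi> r \<in> X" and \<psi>: "\<And>r. \<psi> r \<in> X"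
    and \<phi>_approx: "\<And>v. \<forall>x\<in>X. \<bar>v x\<bar> \<le> 1 \<Longrightarrow>
      \<bar>(\<Sum>r<N. v (\<phi> r)) / N - (\<Sum>x\<in>X. pmf p x * v x)\<bar> \<le> 2 * real (card X) / N"
    and \<psi>_approx: "\<And>v. \<forall>x\<in>X. \<bar>v x\<bar> \<le> 1 \<Longrightarrow>
      \<bar>(\<Sum>r<N. v (\<psi> r)) / N - (\<Sum>x\<in>X. pmf q x * v x)\<bar> \<le> 2 * real (card X) / N"
  defines "S \<equiv> replicate_pmf m (pmf_of_set {..<N})"
    and "H \<equiv> pmf_of_set (X \<rightarrow>\<^sub>E {..<M})"
    and "G \<equiv> replicate_pmf k (pmf_of_set (X \<rightarrow>\<^sub>E {-1, 1::real}))"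
  shows "measure_pmf.prob (pair_pmf S (pair_pmf S (pair_pmf H G)))
    {(r, s, h, gs). \<not> \<bar>outcome h gs (map \<phi> r) (map \<psi> s)
       - measure_pmf.expectation (pair_pmf p q) (\<lambda>(x, y). f x y)\<bar> \<le> 9 * e} \<le> 1 / 3"
proof -
  interpret t: kernel X "\<lambda>x y. f y x" \<sigma> by (rule transpose)
  define E where "E = measure_pmf.expectation (pair_pmf p q) (\<lambda>(x, y). f x y)"
  have E: "E = (\<Sum>x\<in>X. pmf p x * (\<Sum>y\<in>X. pmf q y * f x y))"
    unfolding E_def by (rule expectation_pair_pmf_finite[OF finite_X p finite_X q])
  define v1 where "v1 x = (\<Sum>i<N. f x (\<psi> i)) / N" for x
  define v2 where "v2 xs y = (\<Sum>x\<leftarrow>xs. f x y) / m" for xs y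
  define A1 where "A1 r \<longleftrightarrow> \<bar>sum_list (map v1 (map \<phi> r)) / m - (\<Sum>i<N. v1 (\<phi> i)) / N\<bar> > e" for r
  define A2 where "A2 r s \<longleftrightarrow> \<bar>sum_list (map (v2 (map \<phi> r)) (map \<psi> s)) / m
      - (\<Sum>i<N. v2 (map \<phi> r) (\<psi> i)) / N\<bar> > e" for r s
  define A3 where "A3 r s h \<longleftrightarrow> (\<exists>x\<in>set (heavy K (map \<phi> r)). \<exists>y\<in>big (row_avg (freq (map \<psi> s))).
      x \<noteq> y \<and> h x = h y)" for r s and h :: "'a \<Rightarrow> nat"
  define A4 where "A4 r s h \<longleftrightarrow> (\<exists>x\<in>set (heavy K (map \<psi> s)). \<exists>y\<in>big (col_avg (light_freq K (map \<phi> r))).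
      x \<noteq> y \<and> h x = h y)" for r s and h :: "'a \<Rightarrow> nat"
  define A5 where "A5 r s gs \<longleftrightarrow> \<bar>(\<Sum>g\<leftarrow>gs. (\<Sum>x\<in>X. light_freq K (map \<phi> r) x * g x)
      * (\<Sum>x\<in>X. row_avg (light_freq K (map \<psi> s)) x * g x)) / k
      - bilin (light_freq K (map \<phi> r)) (light_freq K (map \<psi> s))\<bar> > e" for r s gs
  let ?R = "pair_pmf S (pair_pmf S (pair_pmf H G))"
  let ?P = "measure_pmf.prob ?R"
  have S: "length r = m" if "r \<in> set_pmf S" for r
    using that by (simp add: S_def set_replicate_pmf)
  have sub: "set (map \<phi> r) \<subseteq> X" "set (map \<psi> r) \<subseteq> X" for r
    using \<phi> \<psi> by auto
  have v1_le: "\<bar>v1 x\<bar> \<le> 1" if "x \<in> X" for x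
  proof -
    have "\<bar>\<Sum>i<N. f x (\<psi> i)\<bar> \<le> (\<Sum>i<N. 1)"
      using f_bound \<psi> that by (intro order_trans[OF sum_abs] sum_mono) auto
    then show ?thesis using N by (simp add: v1_def)
  qed
  have v2_le: "\<bar>v2 xs y\<bar> \<le> 1" if "y \<in> X" "set xs \<subseteq> X" "length xs = m" for xs y
  proof -
    have "\<bar>\<Sum>x\<leftarrow>xs. f x y\<bar> \<le> (\<Sum>x\<leftarrow>xs. \<bar>f x y\<bar>)"
      using sum_list_abs[of "map (\<lambda>x. f x y) xs"] by (simp add: comp_def)
    also have "\<dots> \<le> (\<Sum>x\<leftarrow>xs. 1)"
      using that f_bound by (intro sum_list_mono) auto
    finally show ?thesis using pos that by (simp add: v2_def sum_list_triv)
  qed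
  have good: "\<bar>outcome h gs (map \<phi> r) (map \<psi> s) - E\<bar> \<le> 9 * e"
    if r: "length r = m" "length s = m" and "\<not> A1 r" "\<not> A2 r s" "\<not> A3 r s h" "\<not> A4 r s h" "\<not> A5 r s gs"
    for r s h gs
  proof -
    let ?xs = "map \<phi> r" and ?ys = "map \<psi> s"
    have o: "\<bar>outcome h gs ?xs ?ys - bilin (freq ?xs) (freq ?ys)\<bar> \<le> 5 * e"
      using that sub unfolding A3_def A4_def A5_def
      by (intro outcome_error) auto
    have b: "bilin (freq ?xs) (freq ?ys) = sum_list (map (v2 ?xs) ?ys) / m"
    proof -
      have c: "col_avg (freq ?xs) y = v2 ?xs y" for y
        using sum_freq[OF finite_X sub(1), of r "\<lambda>x. f x y"] r
        by (simp add: col_avg_def v2_def mult.commute comp_def)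
      show ?thesis
        unfolding bilin_col c using sum_freq[OF finite_X sub(2)] r by simp
    qed
    \<comment> \<open>Exchanging the sums identifies the centre of Bob's deviation with Alice's
      empirical mean, so the two stages chain.\<close>
    have c: "(\<Sum>i<N. v2 ?xs (\<psi> i)) / N = sum_list (map v1 ?xs) / m"
    proof -
      have "(\<Sum>i<N. (\<Sum>x\<leftarrow>xs. f x (\<psi> i))) = (\<Sum>x\<leftarrow>xs. (\<Sum>i<N. f x (\<psi> i)))" for xs
        by (induction xs) (simp_all add: sum.distrib)
      moreover have "sum_list (map v1 xs) = (\<Sum>x\<leftarrow>xs. (\<Sum>i<N. f x (\<psi> i))) / N" for xs
        by (induction xs) (simp_all add: v1_def add_divide_distrib)
      ultimately show ?thesis
        by (simp add: v2_def flip: sum_divide_distrib del: map_map)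
    qed
    have d1: "\<bar>(\<Sum>i<N. v1 (\<phi> i)) / N - (\<Sum>x\<in>X. pmf p x * v1 x)\<bar> \<le> e"
      using \<phi>_approx[of v1] v1_le N by auto
    have d2: "\<bar>(\<Sum>x\<in>X. pmf p x * v1 x) - E\<bar> \<le> e"
    proof -
      have "(\<Sum>x\<in>X. pmf p x * v1 x) - E = (\<Sum>x\<in>X. pmf p x * (v1 x - (\<Sum>y\<in>X. pmf q y * f x y)))"
        by (simp add: E right_diff_distrib sum_subtractf)
      also have "\<bar>\<dots>\<bar> \<le> (\<Sum>x\<in>X. pmf p x * e)"
      proof (rule order_trans[OF sum_abs], rule sum_mono)
        fix x assume "x \<in> X"
        then have "\<bar>v1 x - (\<Sum>y\<in>X. pmf q y * f x y)\<bar> \<le> e"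
          using \<psi>_approx[of "f x"] f_bound N by (auto simp: v1_def)
        then show "\<bar>pmf p x * (v1 x - (\<Sum>y\<in>X. pmf q y * f x y))\<bar> \<le> pmf p x * e"
          by (simp add: abs_mult mult_left_mono)
      qed
      also have "\<dots> = e"
        using sum_pmf_eq_1[OF finite_X p] by (simp flip: sum_distrib_right)
      finally show ?thesis .
    qed
    have a1: "\<bar>sum_list (map v1 ?xs) / m - (\<Sum>i<N. v1 (\<phi> i)) / N\<bar> \<le> e"
      using that(3) by (simp only: A1_def not_less)
    have a2: "\<bar>sum_list (map (v2 ?xs) ?ys) / m - sum_list (map v1 ?xs) / m\<bar> \<le> e"
      using that(4) by (simp only: A2_def not_less c)
    show ?thesis
      using o a1 a2 d1 d2 unfolding b by linarith
  qed
  define B1 where "B1 = {(r :: nat list, w :: nat list \<times> ('a \<Rightarrow> nat) \<times> ('a \<Rightarrow> real) list). A1 r}"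
  define B2 where "B2 = {(r, s, w :: ('a \<Rightarrow> nat) \<times> ('a \<Rightarrow> real) list). A2 r s}"
  define B3 where "B3 = {(r, s, h, gs :: ('a \<Rightarrow> real) list). A3 r s h}"
  define B4 where "B4 = {(r, s, h, gs :: ('a \<Rightarrow> real) list). A4 r s h}"
  define B5 where "B5 = {(r, s, h :: 'a \<Rightarrow> nat, gs). A5 r s gs}"
  have P1: "?P B1 \<le> 1 / 15"
    unfolding B1_def prob_pair_pmf_fst unfolding A1_def S_def
    by (rule sample_prob[OF N(1) v1_le \<phi>])
  have P2: "?P B2 \<le> 1 / 15"
    unfolding B2_def
  proof (rule prob_pair_pmf_le)
    fix r assume r: "r \<in> set_pmf S"
    show "measure_pmf.prob (pair_pmf S (pair_pmf H G)) {(s, w). A2 r s} \<le> 1 / 15"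
      unfolding prob_pair_pmf_fst unfolding A2_def S_def
      by (rule sample_prob[OF N(1) v2_le \<psi>]) (use sub S[OF r] in auto)
  qed
  have P3: "?P B3 \<le> 1 / 15"
    unfolding B3_def
  proof (rule prob_pair_pmf_le, rule prob_pair_pmf_le)
    fix r s assume r: "r \<in> set_pmf S" "s \<in> set_pmf S"
    have ne: "map \<psi> s \<noteq> []" using S[OF r(2)] pos by auto
    show "measure_pmf.prob (pair_pmf H G) {(h, gs). A3 r s h} \<le> 1 / 15"
      unfolding prob_pair_pmf_fst unfolding A3_def H_def
    proof (rule separation_prob[OF sub(1)])
      show "real (card (big (row_avg (freq (map \<psi> s))))) * e\<^sup>2 \<le> \<sigma>\<^sup>2"
        unfolding big_def row_avg_def
        by (rule large_entries_card[OF e(1) sum_freq_sq_le(1)[OF finite_X sub(2) ne]])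
    qed (simp add: S[OF r(1)])
  qed
  have P4: "?P B4 \<le> 1 / 15"
    unfolding B4_def
  proof (rule prob_pair_pmf_le, rule prob_pair_pmf_le)
    fix r s assume r: "r \<in> set_pmf S" "s \<in> set_pmf S"
    have ne: "map \<phi> r \<noteq> []" using S[OF r(1)] pos by auto
    show "measure_pmf.prob (pair_pmf H G) {(h, gs). A4 r s h} \<le> 1 / 15"
      unfolding prob_pair_pmf_fst unfolding A4_def H_def
    proof (rule separation_prob[OF sub(2)])
      show "real (card (big (col_avg (light_freq K (map \<phi> r))))) * e\<^sup>2 \<le> \<sigma>\<^sup>2"
        unfolding big_def col_avg_def
        by (rule t.large_entries_card[OF e(1) sum_freq_sq_le(2)[OF finite_X sub(1) ne]])
    qed (simp add: S[OF r(2)])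
  qed
  have P5: "?P B5 \<le> 1 / 15"
    unfolding B5_def
  proof (rule prob_pair_pmf_le, rule prob_pair_pmf_le, rule prob_pair_pmf_le)
    fix r s assume r: "r \<in> set_pmf S" "s \<in> set_pmf S"
    show "measure_pmf.prob G {gs. A5 r s gs} \<le> 1 / 15"
      unfolding A5_def G_def
      by (rule sketch_prob[OF sub(1) _ sub(2)]) (simp_all add: S r)
  qed
  have union: "?P (A \<union> B) \<le> ?P A + ?P B" for A B
    by (rule measure_Un_le) auto
  have "?P {(r, s, h, gs). \<not> \<bar>outcome h gs (map \<phi> r) (map \<psi> s) - E\<bar> \<le> 9 * e}
      \<le> ?P (B1 \<union> (B2 \<union> (B3 \<union> (B4 \<union> B5))))"
  proof (rule measure_pmf.finite_measure_mono_AE)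
    show "AE w in ?R. w \<in> {(r, s, h, gs). \<not> \<bar>outcome h gs (map \<phi> r) (map \<psi> s) - E\<bar> \<le> 9 * e}
        \<longrightarrow> w \<in> B1 \<union> (B2 \<union> (B3 \<union> (B4 \<union> B5)))"
    proof (rule AE_pmfI, rule impI)
      fix w assume w: "w \<in> set_pmf ?R"
        "w \<in> {(r, s, h, gs). \<not> \<bar>outcome h gs (map \<phi> r) (map \<psi> s) - E\<bar> \<le> 9 * e}"
      obtain r s h gs where eq: "w = (r, s, h, gs)" by (metis prod_cases4)
      have "length r = m" "length s = m" using w(1) S by (auto simp: eq)
      from good[OF this, of h gs] w(2) show "w \<in> B1 \<union> (B2 \<union> (B3 \<union> (B4 \<union> B5)))"
        by (auto simp: eq B1_def B2_def B3_def B4_def B5_def)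
    qed
  qed auto
  also have "\<dots> \<le> 1 / 3"
    using P1 P2 P3 P4 P5 union[of B1 "B2 \<union> (B3 \<union> (B4 \<union> B5))"] union[of B2 "B3 \<union> (B4 \<union> B5)"]
      union[of B3 "B4 \<union> B5"] union[of B4 B5] by linarith
  finally show ?thesis unfolding E_def .
qed

lemma protocol_exists:
  assumes ne: "X \<noteq> {}"
  shows "\<exists>P :: ('a pmf, 'a pmf, real) protocol pmf. (\<forall>\<pi>\<in>set_pmf P. depth \<pi> \<le> cost) \<and>
    (\<forall>p q. set_pmf p \<subseteq> X \<longrightarrow> set_pmf q \<subseteq> X \<longrightarrow>
      measure_pmf.prob P
        {\<pi>. \<bar>run \<pi> p q - measure_pmf.expectation (pair_pmf p q) (\<lambda>(x, y). f x y)\<bar> \<le> 9 * e} \<ge> 2 / 3)"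
proof -
  \<comment> \<open>The grid may be as fine as desired: it belongs to the shared randomness and does
    not enter \<open>cost\<close>.\<close>
  obtain N :: nat where N: "2 * real (card X) / e < N"
    using reals_Archimedean2 by blast
  have N0: "N > 0"
    using le_less_trans[OF _ N, of 0] e by simp
  have N1: "2 * real (card X) / N \<le> e"
    using N N0 e by (simp add: field_simps)
  \<comment> \<open>Distributions not supported in \<open>X\<close> also get a sample map into
    \<open>X\<close>, since the tree must keep all messages in their finite sets for every element
    of the input type.\<close>
  have "\<forall>p. \<exists>\<phi>. (\<forall>r. \<phi> r \<in> X) \<and> (set_pmf p \<subseteq> X \<longrightarrow> (\<forall>v. (\<forall>x\<in>X. \<bar>v x\<bar> \<le> 1) \<longrightarrow>
    \<bar>(\<Sum>r<N. v (\<phi> r)) / N - (\<Sum>x\<in>X. pmf p x * v x)\<bar> \<le> 2 * real (card X) / N))"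
  proof
    fix p :: "'a pmf"
    show "\<exists>\<phi>. (\<forall>r. \<phi> r \<in> X) \<and> (set_pmf p \<subseteq> X \<longrightarrow> (\<forall>v. (\<forall>x\<in>X. \<bar>v x\<bar> \<le> 1) \<longrightarrow>
      \<bar>(\<Sum>r<N. v (\<phi> r)) / N - (\<Sum>x\<in>X. pmf p x * v x)\<bar> \<le> 2 * real (card X) / N))"
    proof (cases "set_pmf p \<subseteq> X")
      case True
      then show ?thesis using pmf_grid_approx[OF finite_X True N0] by blast
    next
      case False
      obtain x where "x \<in> X" using ne by blast
      then show ?thesis using False by (intro exI[of _ "\<lambda>_. x"]) simp
    qed
  qed
  from choice[OF this] obtain \<phi> where \<phi>: "\<And>p r. \<phi> p r \<in> X"
    and approx: "\<And>p v. set_pmf p \<subseteq> X \<Longrightarrow> \<forall>x\<in>X. \<bar>v x\<bar> \<le> 1 \<Longrightarrow>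
      \<bar>(\<Sum>r<N. v (\<phi> p r)) / N - (\<Sum>x\<in>X. pmf p x * v x)\<bar> \<le> 2 * real (card X) / N"
    by blast
  define S where "S = replicate_pmf m (pmf_of_set {..<N})"
  define H where "H = pmf_of_set (X \<rightarrow>\<^sub>E {..<M})"
  define G where "G = replicate_pmf k (pmf_of_set (X \<rightarrow>\<^sub>E {-1, 1::real}))"
  define R where "R = pair_pmf S (pair_pmf S (pair_pmf H G))"
  define Val where "Val w p q = (case w of (r, s, h, gs) \<Rightarrow> outcome h gs (map (\<phi> p) r) (map (\<phi> q) s))"
    for w p q
  have setH: "set_pmf H = X \<rightarrow>\<^sub>E {..<M}"
    unfolding H_def using finite_X pos by (intro set_pmf_of_set) (auto intro: finite_PiE simp: PiE_eq_empty_iff)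
  have setG: "set_pmf G = {gs. set gs \<subseteq> X \<rightarrow>\<^sub>E {-1, 1} \<and> length gs = k}"
    unfolding G_def set_replicate_pmf using finite_X
    by (subst set_pmf_of_set) (auto intro: finite_PiE simp: PiE_eq_empty_iff)
  \<comment> \<open>Each value of the randomness fixes one deterministic tree; the protocol is the
    image of \<open>R\<close> under a choice of such trees.\<close>
  have "\<forall>w\<in>set_pmf R. \<exists>\<pi>. depth \<pi> \<le> cost \<and> (\<forall>p q. run \<pi> p q = Val w p q)"
  proof
    fix w assume w: "w \<in> set_pmf R"
    obtain r s h gs where eq: "w = (r, s, h, gs)" by (metis prod_cases4)
    have "length r = m" "length s = m" and h: "h \<in> X \<rightarrow>\<^sub>E {..<M}"
      and gs: "set gs \<subseteq> X \<rightarrow>\<^sub>E {-1, 1}" "length gs = k"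
      using w by (simp_all add: eq R_def S_def set_replicate_pmf setH setG)
    then show "\<exists>\<pi>. depth \<pi> \<le> cost \<and> (\<forall>p q. run \<pi> p q = Val w p q)"
      unfolding eq Val_def prod.case using \<phi> by (intro outcome_protocol[OF h gs]) auto
  qed
  from bchoice[OF this] obtain build where
    build: "\<And>w. w \<in> set_pmf R \<Longrightarrow> depth (build w) \<le> cost"
      "\<And>w p q. w \<in> set_pmf R \<Longrightarrow> run (build w) p q = Val w p q"
    by blast
  show ?thesis
  proof (intro exI[of _ "map_pmf build R"] conjI allI impI ballI)
    fix \<pi> assume "\<pi> \<in> set_pmf (map_pmf build R)"
    then show "depth \<pi> \<le> cost" using build by auto
  next
    fix p q :: "'a pmf" assume p: "set_pmf p \<subseteq> X" and q: "set_pmf q \<subseteq> X"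
    let ?E = "measure_pmf.expectation (pair_pmf p q) (\<lambda>(x, y). f x y)"
    define Bad where "Bad = {(r, s, h, gs). \<not> \<bar>outcome h gs (map (\<phi> p) r) (map (\<phi> q) s) - ?E\<bar> \<le> 9 * e}"
    have "measure_pmf.prob R Bad \<le> 1 / 3"
      unfolding R_def S_def H_def G_def Bad_def
      by (rule outcome_prob[OF N0 N1 p q \<phi> \<phi> approx[OF p] approx[OF q]])
    then have "2 / 3 \<le> measure_pmf.prob R (- Bad)"
      using measure_pmf.prob_compl[of Bad R] by (simp add: Compl_eq_Diff_UNIV)
    also have "\<dots> \<le> measure_pmf.prob R (build -` {\<pi>. \<bar>run \<pi> p q - ?E\<bar> \<le> 9 * e})"
    proof (rule measure_pmf.finite_measure_mono_AE)
      show "AE w in R. w \<in> - Bad \<longrightarrow> w \<in> build -` {\<pi>. \<bar>run \<pi> p q - ?E\<bar> \<le> 9 * e}"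
        by (rule AE_pmfI) (auto simp: Bad_def build Val_def)
    qed auto
    finally show "2 / 3 \<le> measure_pmf.prob (map_pmf build R) {\<pi>. \<bar>run \<pi> p q - ?E\<bar> \<le> 9 * e}"
      by (simp add: measure_map_pmf)
  qed
qed

end

section \<open>Choice of parameters\<close>

text \<open>For the regimes where answering 0 is already accurate. The second bound is
  Cauchy-Schwarz, as a probability vector has 2-norm at most 1.\<close>

lemma (in kernel) pmf_average_bounds:
  assumes p: "set_pmf p \<subseteq> X" and q: "set_pmf q \<subseteq> X" and \<sigma>: "\<sigma> \<ge> 0"
  shows "\<bar>measure_pmf.expectation (pair_pmf p q) (\<lambda>(x, y). f x y)\<bar> \<le> 1"
    and "\<bar>measure_pmf.expectation (pair_pmf p q) (\<lambda>(x, y). f x y)\<bar> \<le> \<sigma>"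
proof -
  define E where "E = measure_pmf.expectation (pair_pmf p q) (\<lambda>(x, y). f x y)"
  define r where "r x = (\<Sum>y\<in>X. f x y * pmf q y)" for x
  have one: "(\<Sum>x\<in>X. pmf p x) = 1" "(\<Sum>x\<in>X. pmf q x) = 1"
    using finite_X p q by (simp_all add: sum_pmf_eq_1)
  have E: "E = (\<Sum>x\<in>X. pmf p x * r x)"
    unfolding E_def r_def expectation_pair_pmf_finite[OF finite_X p finite_X q]
    by (simp add: mult.commute)
  have r1: "\<bar>r x\<bar> \<le> 1" if "x \<in> X" for x
    unfolding r_def using that one by (intro weighted_average_le_1) auto
  have "\<bar>E\<bar> \<le> (\<Sum>x\<in>X. pmf p x)"
    unfolding E using r1
    by (intro order_trans[OF sum_abs] sum_mono) (auto simp: abs_mult mult_left_le)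
  then show "\<bar>E\<bar> \<le> 1" using one by simp
  have sq: "(\<Sum>x\<in>X. (pmf P x)\<^sup>2) \<le> 1" if "(\<Sum>x\<in>X. pmf P x) = 1" for P
  proof -
    have "(\<Sum>x\<in>X. (pmf P x)\<^sup>2) \<le> (\<Sum>x\<in>X. pmf P x)"
      by (intro sum_mono) (simp add: power2_eq_square mult_left_le pmf_le_1)
    then show ?thesis using that by simp
  qed
  have "E\<^sup>2 \<le> (\<Sum>x\<in>X. (pmf p x)\<^sup>2) * (\<Sum>x\<in>X. (r x)\<^sup>2)"
    unfolding E by (rule Cauchy_Schwarz_ineq_sum)
  also have "\<dots> \<le> 1 * (\<sigma>\<^sup>2 * (\<Sum>x\<in>X. (pmf q x)\<^sup>2))"
    using row_bound[of "pmf q"] sq[OF one(1)] unfolding r_def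
    by (intro mult_mono) (auto simp: sum_nonneg)
  also have "\<dots> \<le> 1 * (\<sigma>\<^sup>2 * 1)"
    using sq[OF one(2)] by (intro mult_left_mono) auto
  finally have "E\<^sup>2 \<le> \<sigma>\<^sup>2" by simp
  then show "\<bar>E\<bar> \<le> \<sigma>" using \<sigma> by (simp add: abs_le_square_iff[symmetric])
qed

lemma cube_kernel:
  assumes "\<forall>x\<in>cube n. \<forall>y\<in>cube n. f x y \<in> {-1..1}"
  shows "kernel (cube n) f (max_singular_value n f)"
proof
  show "\<bar>f x y\<bar> \<le> 1" if "x \<in> cube n" "y \<in> cube n" for x y
    using assms that by (force simp: abs_le_iff)
qed (use finite_cube max_singular_value_bound(2) in auto)

lemma estimation_complexity_le:
  assumes "estimates n f \<epsilon> P" "\<forall>\<pi>\<in>set_pmf P. depth \<pi> \<le> d"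
  shows "ereal_of_enat (estimation_complexity \<epsilon> n f) \<le> ereal (real d)"
proof -
  have "estimation_complexity \<epsilon> n f \<le> enat d"
    unfolding estimation_complexity_def using assms by (intro Inf_lower) blast
  then have "ereal_of_enat (estimation_complexity \<epsilon> n f) \<le> ereal_of_enat (enat d)"
    by (simp only: ereal_of_enat_le_iff)
  then show ?thesis by simp
qed

text \<open>The largest alphabet has about \<open>M * m\<close> symbols, with \<open>m\<close> of
  order \<open>\<eta>\<^sup>2\<close> and \<open>M\<close> of order \<open>m * s\<^sup>2\<close>;
  this explains the powers of \<open>s\<close> and \<open>\<eta>\<close>. The factor
  \<open>2 ^ 32\<close> absorbs the explicit constants.\<close>

lemma bits_for:
  fixes s \<eta> :: real
  assumes s: "s \<ge> 1" and \<eta>: "\<eta> \<ge> 1"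
  obtains b :: nat where "2 ^ 32 * s\<^sup>2 * \<eta> ^ 4 \<le> 2 ^ b" "real b \<le> 33 + 3 * ln s + 6 * ln \<eta>"
proof -
  define D where "D = 2 ^ 32 * s\<^sup>2 * \<eta> ^ 4"
  have D: "D > 1"
  proof -
    have "1 * 1 \<le> s\<^sup>2 * \<eta> ^ 4" using s \<eta> by (intro mult_mono) auto
    then show ?thesis by (simp add: D_def mult.assoc)
  qed
  define b where "b = nat \<lceil>log 2 D\<rceil>"
  have log: "log 2 D > 0" using D by simp
  have b: "log 2 D \<le> real b" "real b \<le> log 2 D + 1"
    using log unfolding b_def by (simp_all add: of_nat_nat)
  have "D = 2 powr (log 2 D)" using D by simp
  also have "\<dots> \<le> 2 powr (real b)" using b by (intro powr_mono) auto
  also have "\<dots> = 2 ^ b" by (simp add: powr_realpow)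
  finally have "D \<le> 2 ^ b" .
  moreover have "real b \<le> 33 + 3 * ln s + 6 * ln \<eta>"
  proof -
    have lnD: "ln D = 32 * ln 2 + 2 * ln s + 4 * ln \<eta>"
      using s \<eta> ln_realpow[of "2::real" 32] by (simp add: D_def ln_mult ln_realpow)
    have nn: "ln s \<ge> 0" "ln \<eta> \<ge> 0" using s \<eta> by simp_all
    \<comment> \<open>Passing to base 2 divides by \<open>ln 2\<close>, at least 2/3, which turns
      the coefficients 2 and 4 into 3 and 6.\<close>
    have "2 * ln s + 4 * ln \<eta> \<le> (3 * ln s + 6 * ln \<eta>) * ln 2"
      using mult_left_mono[OF ln2_ge_two_thirds, of "3 * ln s + 6 * ln \<eta>"] nn by simp
    then have "ln D \<le> (32 + 3 * ln s + 6 * ln \<eta>) * ln 2"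
      by (simp add: lnD algebra_simps)
    then have "log 2 D \<le> 32 + 3 * ln s + 6 * ln \<eta>"
      by (simp add: log_def divide_le_eq)
    then show ?thesis using b by simp
  qed
  ultimately show ?thesis using that by (simp add: D_def)
qed

text \<open>Removes the logarithm of \<open>s\<close>. Up to \<open>(1 / \<epsilon>) ^ 4\<close> it
  is comparable to the logarithm of 1/\<epsilon>. Beyond that, the sample-size bound on
  \<open>K\<close> is of order at most the square root of \<open>s\<close>, and the remaining
  \<open>s powr (1 / 6)\<close> pays for the logarithm.\<close>

lemma cost_bound:
  fixes s \<epsilon> K b :: real
  assumes \<epsilon>: "0 < \<epsilon>" "\<epsilon> < 1" and s: "s \<ge> 1"
    and b: "0 \<le> b" "b \<le> 33 + 3 * ln s + 6 * ln (1 / \<epsilon>)"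
    and K: "0 \<le> K" "K \<le> 2 * s powr (2 / 3)" "K \<le> 1216 / \<epsilon>\<^sup>2"
  shows "K * b \<le> 72960 * (ln (2 + 1 / \<epsilon>) * s powr (2 / 3))"
proof -
  \<comment> \<open>With the sixth root, the square root of \<open>s\<close> is \<open>t ^ 3\<close>
    and the target is \<open>t ^ 4\<close>.\<close>
  define t where "t = s powr (1 / 6)"
  define L where "L = ln (2 + 1 / \<epsilon>)"
  have t1: "t \<ge> 1" unfolding t_def using s by (simp add: ge_one_powr_ge_zero)
  have tp: "t ^ j = s powr (real j / 6)" for j
    using s by (simp add: t_def powr_powr flip: powr_realpow)
  have t: "s = t ^ 6" "s powr (2 / 3) = t ^ 4"
    using tp[of 6] tp[of 4] s by simp_all
  have \<eta>: "1 / \<epsilon> > 1" using \<epsilon> by simp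
  have "exp 1 \<le> (3::real)" using exp_le by simp
  then have L1: "L \<ge> 1"
    unfolding L_def using \<eta> by (subst ln_ge_iff) linarith+
  have \<eta>L: "ln (1 / \<epsilon>) \<le> L"
    unfolding L_def using \<eta> \<epsilon> by (intro ln_mono) auto
  have lns: "ln s = 6 * ln t" using t1 by (simp add: t(1) ln_realpow)
  have lnt: "ln t \<le> t" "ln t \<ge> 0" using t1 ln_le_minus_one[of t] by simp_all
  have "K * b \<le> 72960 * (L * t ^ 4)"
  proof (cases "s \<le> (1 / \<epsilon>) ^ 4")
    case True
    have "ln s \<le> ln ((1 / \<epsilon>) ^ 4)" using True s \<epsilon> by (intro ln_mono) auto
    also have "\<dots> = 4 * ln (1 / \<epsilon>)" using \<eta> by (subst ln_realpow) auto
    finally have "ln s \<le> 4 * L" using \<eta>L by simp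
    \<comment> \<open>51 = 33 + 3 * 4 + 6, using that \<open>L\<close> is at least 1.\<close>
    then have "b \<le> 51 * L" using b \<eta>L L1 by linarith
    then have "K * b \<le> (2 * t ^ 4) * (51 * L)"
      using K b t by (intro mult_mono) auto
    also have "\<dots> \<le> 72960 * (L * t ^ 4)"
      using L1 t1 by (simp add: mult_ac)
    finally show ?thesis .
  next
    case False
    have "ln ((1 / \<epsilon>) ^ 4) \<le> ln s" using False \<epsilon> by (intro ln_mono) auto
    then have "4 * ln (1 / \<epsilon>) \<le> ln s" using \<eta> by (subst (asm) ln_realpow) auto
    \<comment> \<open>60 = 33 + 18 + 9: here \<open>3 * ln s\<close> is \<open>18 * ln t\<close>,
      \<open>6 * ln (1 / \<epsilon>)\<close> is at most \<open>9 * ln t\<close>, and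
      \<open>ln t\<close> is at most \<open>t\<close>.\<close>
    then have "b \<le> 60 * t" using b lns lnt t1 by linarith
    moreover have "K \<le> 1216 * t ^ 3"
    proof -
      have "((1 / \<epsilon>)\<^sup>2)\<^sup>2 \<le> (t ^ 3)\<^sup>2"
        using False t(1) power_mult[of "1 / \<epsilon>" 2 2] power_mult[of t 3 2] by simp
      then have "(1 / \<epsilon>)\<^sup>2 \<le> t ^ 3"
        by (rule power2_le_imp_le) (use t1 in simp)
      then show ?thesis using K(3) by (simp add: power_divide)
    qed
    ultimately have "K * b \<le> (1216 * t ^ 3) * (60 * t)"
      using K b t1 by (intro mult_mono) auto
    also have "\<dots> = 72960 * (1 * t ^ 4)"
      by (simp add: power_numeral_reduce)
    also have "\<dots> \<le> 72960 * (L * t ^ 4)"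
      using L1 t1 by (intro mult_left_mono mult_right_mono) auto
    finally show ?thesis .
  qed
  then show ?thesis by (simp add: L_def t(2))
qed

lemma estimation_complexity_bound:
  assumes \<epsilon>: "0 < \<epsilon>" "\<epsilon> < 1" and f: "\<forall>x\<in>cube n. \<forall>y\<in>cube n. f x y \<in> {-1..1}"
  defines "\<sigma> \<equiv> max_singular_value n f"
  assumes \<sigma>: "\<epsilon> < \<sigma>"
  shows "ereal_of_enat (estimation_complexity \<epsilon> n f)
    \<le> ereal (2434 * 72960 * (ln (2 + 1 / \<epsilon>) * (\<sigma> / \<epsilon>) powr (2 / 3)))"
proof -
  define s where "s = \<sigma> / \<epsilon>"
  define \<eta> where "\<eta> = 1 / \<epsilon>"
  have s1: "s > 1" using \<sigma> \<epsilon> by (simp add: s_def)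
  have \<eta>1: "\<eta> > 1" using \<epsilon> by (simp add: \<eta>_def)
  have \<sigma>s: "\<sigma> = s * \<epsilon>" using \<epsilon> by (simp add: s_def)
  have \<eta>\<epsilon>: "\<eta> * \<epsilon> = 1" using \<epsilon> by (simp add: \<eta>_def)
  \<comment> \<open>1215 = 15 * 81, from \<open>15 \<le> m * e\<^sup>2\<close> with
    \<open>e = \<epsilon> / 9\<close>; rounding up costs at most one more
    \<open>\<eta>\<^sup>2\<close>.\<close>
  define m where "m = nat \<lceil>1215 * \<eta>\<^sup>2\<rceil>"
  have \<eta>2: "\<eta>\<^sup>2 \<ge> 1" using \<eta>1 by simp
  have m: "1215 * \<eta>\<^sup>2 \<le> m" "real m \<le> 1216 * \<eta>\<^sup>2"
    using \<eta>2 unfolding m_def by (simp_all add: of_nat_nat) linarith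
  have m1: "real m \<ge> 1" using m \<eta>2 by linarith
  define K where "K = min m (nat \<lceil>s powr (2 / 3)\<rceil>)"
  have s23: "s powr (2 / 3) \<ge> 1" using s1 by (simp add: ge_one_powr_ge_zero)
  have ceil: "s powr (2 / 3) \<le> real (nat \<lceil>s powr (2 / 3)\<rceil>)"
    "real (nat \<lceil>s powr (2 / 3)\<rceil>) \<le> 2 * s powr (2 / 3)"
    using s23 by (simp_all add: of_nat_nat) linarith
  have K1: "K \<ge> 1" using m1 ceil(1) s23 unfolding K_def by linarith
  have Km: "K \<le> m" by (simp add: K_def)
  have K2: "real K \<le> 2 * s powr (2 / 3)" using ceil(2) unfolding K_def by linarith
  \<comment> \<open>2430 = 30 * 81, again from \<open>e = \<epsilon> / 9\<close>. In
    \<open>M\<close> below, 1215 is 15 * 81 and \<open>K\<close> has been replaced by its bound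
    \<open>m\<close>.\<close>
  define k where "k = 2430 * K"
  define M where "M = nat \<lceil>1215 * m * s\<^sup>2\<rceil>"
  have s2: "s\<^sup>2 \<ge> 1" using s1 by simp
  have ms2: "real m * s\<^sup>2 \<ge> 1" using mult_mono[OF m1 s2] m1 by simp
  have M: "1215 * m * s\<^sup>2 \<le> M" "real M \<le> 1216 * (m * s\<^sup>2)"
    using ms2 unfolding M_def by (simp_all add: of_nat_nat) linarith
  obtain b where b: "2 ^ 32 * s\<^sup>2 * \<eta> ^ 4 \<le> 2 ^ b" "real b \<le> 33 + 3 * ln s + 6 * ln \<eta>"
    using bits_for[of s \<eta>] s1 \<eta>1 by force
  define e where "e = \<epsilon> / 9"
  have e2: "e\<^sup>2 = \<epsilon>\<^sup>2 / 81" by (simp add: e_def power_divide)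
  have \<eta>\<epsilon>2: "\<eta>\<^sup>2 * \<epsilon>\<^sup>2 = 1" using \<eta>\<epsilon> by (simp flip: power_mult_distrib)
  interpret kernel "cube n" f \<sigma>
    unfolding \<sigma>_def by (rule cube_kernel[OF f])
  interpret estimator "cube n" f \<sigma> e m K M k b
  proof unfold_locales
    show "0 < e" "e \<le> 1 / 4" using \<epsilon> by (simp_all add: e_def)
    show "m > 0" "K > 0" "k > 0" using m1 K1 by (simp_all add: k_def)
    have "real M > 0" using M(1) ms2 unfolding mult.assoc by linarith
    then show "M > 0" by simp
    have "15 = 1215 * \<eta>\<^sup>2 * e\<^sup>2" using \<eta>\<epsilon>2 by (simp add: e2 mult.assoc)
    also have "\<dots> \<le> m * e\<^sup>2" using m by (intro mult_right_mono) auto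
    finally show "15 \<le> m * e\<^sup>2" .
    have "15 * real K * \<sigma>\<^sup>2 \<le> 15 * real m * \<sigma>\<^sup>2"
      using Km by (intro mult_right_mono) auto
    also have "\<dots> = 1215 * m * s\<^sup>2 * e\<^sup>2"
      by (simp add: \<sigma>s e2 power_mult_distrib)
    also have "\<dots> \<le> M * e\<^sup>2" using M by (intro mult_right_mono) auto
    finally show "15 * K * \<sigma>\<^sup>2 \<le> M * e\<^sup>2" by simp
    show "m \<le> K \<or> 30 * \<sigma>\<^sup>2 \<le> k * (real K)\<^sup>2 * e\<^sup>2"
    proof (cases "m \<le> K")
      case False
      then have "s powr (2 / 3) \<le> K" using ceil by (simp add: K_def min_def split: if_splits)
      then have "(s powr (2 / 3)) ^ 3 \<le> real K ^ 3" using s23 by (intro power_mono) auto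
      moreover have "(s powr (2 / 3)) ^ 3 = s\<^sup>2"
        using s1 by (simp add: powr_power)
      ultimately have "s\<^sup>2 * \<epsilon>\<^sup>2 \<le> real K ^ 3 * \<epsilon>\<^sup>2" by (intro mult_right_mono) auto
      moreover have "30 * \<sigma>\<^sup>2 = 30 * (s\<^sup>2 * \<epsilon>\<^sup>2)"
        by (simp only: \<sigma>s power_mult_distrib)
      moreover have "k * (real K)\<^sup>2 * e\<^sup>2 = 30 * (real K ^ 3 * \<epsilon>\<^sup>2)"
        by (simp add: k_def e2 power3_eq_cube power2_eq_square[of "real K"])
      ultimately have "30 * \<sigma>\<^sup>2 \<le> k * (real K)\<^sup>2 * e\<^sup>2" by linarith
      then show ?thesis by (rule disjI2)
    qed (rule disjI1)
    have m2: "real m * real m \<le> 1478656 * \<eta> ^ 4"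
    proof -
      have "real m * real m \<le> (1216 * \<eta>\<^sup>2) * (1216 * \<eta>\<^sup>2)" using m by (intro mult_mono) auto
      also have "\<dots> = 1478656 * \<eta> ^ 4" by (simp add: power2_eq_square power4_eq_xxxx)
      finally show ?thesis .
    qed
    have "real (M * (m + 1) + 1) \<le> 2 ^ 32 * s\<^sup>2 * \<eta> ^ 4"
    proof -
      \<comment> \<open>Both \<open>m + 1 \<le> 2 * m\<close> and the final 1 are charged to
        \<open>m * m * s\<^sup>2\<close>, giving 2433 = 2 * 1216 + 1.\<close>
      have "real M * (m + 1) + 1 \<le> 1216 * (m * s\<^sup>2) * (2 * m) + m * m * s\<^sup>2"
      proof (rule add_mono)
        show "real M * (m + 1) \<le> 1216 * (m * s\<^sup>2) * (2 * m)"
          using M m1 by (intro mult_mono) auto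
        show "1 \<le> real (m * m) * s\<^sup>2"
          using mult_mono[OF m1 ms2] m1 by (simp add: mult.assoc)
      qed
      also have "\<dots> = 2433 * ((real m * real m) * s\<^sup>2)" by (simp add: algebra_simps)
      also have "\<dots> \<le> 2433 * ((1478656 * \<eta> ^ 4) * s\<^sup>2)"
        using m2 by (intro mult_left_mono mult_right_mono) auto
      also have "\<dots> = 3597570048 * (s\<^sup>2 * \<eta> ^ 4)" by simp
      also have "\<dots> \<le> 2 ^ 32 * (s\<^sup>2 * \<eta> ^ 4)"
        by (intro mult_right_mono) auto
      finally show ?thesis by (simp add: algebra_simps)
    qed
    also note b(1)
    finally have "real (M * (m + 1) + 1) \<le> real (2 ^ b)"
      by (simp only: of_nat_power of_nat_numeral)
    then show "M * (m + 1) + 1 \<le> 2 ^ b" by (simp only: of_nat_le_iff)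
    have \<eta>24: "\<eta>\<^sup>2 \<le> s\<^sup>2 * \<eta> ^ 4" "\<eta> \<le> s\<^sup>2 * \<eta> ^ 4" "1 \<le> s\<^sup>2 * \<eta> ^ 4"
    proof -
      have "\<eta> ^ j \<le> s\<^sup>2 * \<eta> ^ 4" if "j \<le> 4" for j
        using mult_mono[OF s2 power_increasing[OF that, of \<eta>]] \<eta>1 by simp
      from this[of 2] this[of 1] this[of 0]
      show "\<eta>\<^sup>2 \<le> s\<^sup>2 * \<eta> ^ 4" "\<eta> \<le> s\<^sup>2 * \<eta> ^ 4" "1 \<le> s\<^sup>2 * \<eta> ^ 4" by simp_all
    qed
    have "real (2 * m + 1) \<le> 2 ^ 32 * s\<^sup>2 * \<eta> ^ 4"
      using m \<eta>24 by simp
    also note b(1)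
    finally have "real (2 * m + 1) \<le> real (2 ^ b)"
      by (simp only: of_nat_power of_nat_numeral)
    then show "2 * m + 1 \<le> 2 ^ b" by (simp only: of_nat_le_iff)
    have "4 / e + 2 = 36 * \<eta> + 2" by (simp add: e_def \<eta>_def)
    also have "\<dots> \<le> 2 ^ 32 * s\<^sup>2 * \<eta> ^ 4" using \<eta>24 by simp
    also note b(1)
    finally show "4 / e + 2 \<le> 2 ^ b" .
  qed
  have "cube n \<noteq> {}" using card_cube[of n] by fastforce
  then obtain P where P: "\<forall>\<pi>\<in>set_pmf P. depth \<pi> \<le> cost"
    "\<forall>p q. set_pmf p \<subseteq> cube n \<longrightarrow> set_pmf q \<subseteq> cube n \<longrightarrow>
      measure_pmf.prob P
        {\<pi>. \<bar>run \<pi> p q - measure_pmf.expectation (pair_pmf p q) (\<lambda>(x, y). f x y)\<bar> \<le> 9 * e} \<ge> 2 / 3"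
    using protocol_exists by blast
  have "9 * e = \<epsilon>" by (simp add: e_def)
  then have "estimates n f \<epsilon> P" using P(2) by (simp add: estimates_def)
  from estimation_complexity_le[OF this P(1)]
  have le: "ereal_of_enat (estimation_complexity \<epsilon> n f) \<le> ereal (real cost)" .
  have "real cost \<le> 2434 * (real K * real b)"
  proof -
    \<comment> \<open>The two rounded values cost \<open>b\<close> bits each, charged as
      \<open>K * b\<close>: 2434 = 1 + 1 + 2430 + 1 + 1.\<close>
    have "1 * b \<le> K * b" using K1 by (intro mult_le_mono1)
    then have "cost \<le> 2434 * (K * b)"
      unfolding cost_def by (simp add: k_def)
    then have "real cost \<le> real (2434 * (K * b))" by (simp only: of_nat_le_iff)
    then show ?thesis by simp
  qed
  also have "\<dots> \<le> 2434 * (72960 * (ln (2 + 1 / \<epsilon>) * s powr (2 / 3)))"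
  proof (intro mult_left_mono cost_bound)
    have "real K \<le> 1216 * \<eta>\<^sup>2" using Km m(2) by linarith
    then show "real K \<le> 1216 / \<epsilon>\<^sup>2" by (simp add: \<eta>_def power_divide)
  qed (use \<epsilon> s1 b K2 in \<open>simp_all add: \<eta>_def\<close>)
  finally have "real cost \<le> 2434 * 72960 * (ln (2 + 1 / \<epsilon>) * (\<sigma> / \<epsilon>) powr (2 / 3))"
    by (simp add: s_def)
  with le show ?thesis
    by (rule order_trans[OF _ ereal_less_eq(3)[THEN iffD2]])
qed

theorem theorem2p11:
  "\<exists>(C::real) (k::nat). C > 0 \<and>
     (\<forall>(n::nat) (f :: bool list \<Rightarrow> bool list \<Rightarrow> real) (\<epsilon>::real).
        \<epsilon> > 0 \<longrightarrow> (\<forall>x\<in>cube n. \<forall>y\<in>cube n. f x y \<in> {-1..1}) \<longrightarrow>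
        ereal_of_enat (estimation_complexity \<epsilon> n f)
          \<le> ereal (C * ln (2 + 1 / \<epsilon>) ^ k * (max_singular_value n f / \<epsilon>) powr (2 / 3)))"
proof (rule exI[of _ "2434 * 72960"], rule exI[of _ 1], intro conjI allI impI)
  fix n and f :: "bool list \<Rightarrow> bool list \<Rightarrow> real" and \<epsilon> :: real
  assume \<epsilon>: "\<epsilon> > 0" and f: "\<forall>x\<in>cube n. \<forall>y\<in>cube n. f x y \<in> {-1..1}"
  let ?\<sigma> = "max_singular_value n f"
  let ?B = "2434 * 72960 * ln (2 + 1 / \<epsilon>) ^ 1 * (?\<sigma> / \<epsilon>) powr (2 / 3)"
  interpret kernel "cube n" f ?\<sigma> by (rule cube_kernel[OF f])
  show "ereal_of_enat (estimation_complexity \<epsilon> n f) \<le> ereal ?B"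
  proof (cases "\<epsilon> < 1 \<and> \<epsilon> < ?\<sigma>")
    case True
    then show ?thesis
      unfolding power_one_right mult.assoc[of _ "ln _"]
      by (intro estimation_complexity_bound \<epsilon> f conjunct1[OF True] conjunct2[OF True])
  next
    case False
    \<comment> \<open>Here \<epsilon> is at least 1 or at least the largest singular value, and
      either of these bounds the expectation, so the silent protocol answering 0 succeeds.\<close>
    have "estimates n f \<epsilon> (return_pmf (Output 0))"
      unfolding estimates_def
    proof (intro allI impI)
      fix p q assume pq: "set_pmf p \<subseteq> cube n" "set_pmf q \<subseteq> cube n"
      have "\<bar>measure_pmf.expectation (pair_pmf p q) (\<lambda>(x, y). f x y)\<bar> \<le> \<epsilon>"
        using pmf_average_bounds[OF pq max_singular_value_bound(1)] False by linarith
      then show "2 / 3 \<le> measure_pmf.prob (return_pmf (Output 0))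
        {\<pi>. \<bar>run \<pi> p q - measure_pmf.expectation (pair_pmf p q) (\<lambda>(x, y). f x y)\<bar> \<le> \<epsilon>}"
        by (simp add: measure_return_pmf)
    qed
    then have "ereal_of_enat (estimation_complexity \<epsilon> n f) \<le> ereal (real 0)"
      by (rule estimation_complexity_le) simp
    moreover have "real 0 \<le> ?B"
    proof -
      have "1 / \<epsilon> > 0" using \<epsilon> by simp
      then have "ln (2 + 1 / \<epsilon>) \<ge> 0" by (intro ln_ge_zero) linarith
      then show ?thesis unfolding of_nat_0 by (intro mult_nonneg_nonneg) simp_all
    qed
    ultimately show ?thesis
      by (rule order_trans[OF _ ereal_less_eq(3)[THEN iffD2]])
  qed
qed simp

end
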